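(* Consider the following randomized recursive procedure $\mathrm{UnifDOAG}(n,m,k)$, defined for integers with $D_{n,m,k} > 0$, assuming the table of numbers $D_{n',m',k'}$ is available. If $n = 1$, return the unique DOAG with one vertex. Otherwise: (1) draw a uniform integer $r \in [0, D_{n,m,k}-1]$ and sum the terms $T(p,i) = D_{n-1,m-p,k-1+p-i}\binom{n-k-p+i}{i}\binom{p}{i} i!$ over pairs $(p,i)$ with $0 \le i \le p$ in lexicographic order until the partial sum exceeds $r$, and keep the last pair $(p,i)$ (so that $(p,i)$ is picked with probability $T(p,i)/D_{n,m,k}$); (2) let $D' = \mathrm{UnifDOAG}(n-1, m-p, k-1+p-i)$; (3) choose a uniform subset $I$ of size $i$ of the non-source vertices of $D'$, put it in a uniform random order, and uniformly interleave this ordered list with the list of the $s = p-i$ largest sources of $D'$ (with respect to the source order of $D'$, kept in that order); call the resulting list $E$; (4) return the DOAG obtained by adding to $D'$ a new vertex whose list of outgoing edges, in order, points to the elements of $E$, where this new vertex is the smallest source, the $s$ sources of $D'$ it points to become non-sources, and the remaining sources of $D'$ keep their relative order. Then $\mathrm{UnifDOAG}(n,m,k)$ returns a DOAG distributed uniformly among the DOAGs with $n$ vertices, $m$ edges and $k$ sources, and it performs $O\left(\sum_v d_v^2\right)$ multiplications of integers, where $v$ ranges over the vertices of the returned graph and $d_v$ is the out-degree of $v$.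
   Context: A directed ordered acyclic graph (DOAG) is a tuple $(V, E, (\prec_v)_{v \in V \cup \{\emptyset\}})$ where $V$ is a finite set of vertices, $E \subseteq V \times V$ is a set of edges such that the directed graph $(V,E)$ is acyclic, for each $v \in V$, $\prec_v$ is a total order on the set of outgoing edges of $v$, and $\prec_\emptyset$ is a total order on the set of sources (vertices with no incoming edge). Two DOAGs are considered equal if there is a bijection between their vertex sets preserving the edges and all the orders. $D_{n,m,k}$ denotes the number of DOAGs with $n$ vertices, $m$ edges and $k$ sources. *)

theory Defs
  imports
    "HOL-Probability.Probability"
    "HOL-Combinatorics.Multiset_Permutations"
    "HOL-Library.State_Monad"
begin

section \<open>Directed ordered acyclic graphs\<close>

record 'v dograph =
  verts :: "'v set"
  edges :: "'v rel"
  edge_ord :: "'v \<Rightarrow> ('v \<times> 'v) rel"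
  src_ord :: "'v rel"

definition out_edges :: "'v dograph \<Rightarrow> 'v \<Rightarrow> ('v \<times> 'v) set" where
  "out_edges G v = {e \<in> edges G. fst e = v}"

definition out_degree :: "'v dograph \<Rightarrow> 'v \<Rightarrow> nat" where
  "out_degree G v = card (out_edges G v)"

definition sources :: "'v dograph \<Rightarrow> 'v set" where
  "sources G = {v \<in> verts G. \<nexists>u. (u, v) \<in> edges G}"

definition strict_total_order :: "'a set \<Rightarrow> 'a rel \<Rightarrow> bool" where
  "strict_total_order A r \<longleftrightarrow> r \<subseteq> A \<times> A \<and> strict_linear_order_on A r"

definition is_doag :: "'v dograph \<Rightarrow> bool" where
  "is_doag G \<longleftrightarrow>
     finite (verts G) \<and>
     edges G \<subseteq> verts G \<times> verts G \<and>
     acyclic (edges G) \<and>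
     (\<forall>v\<in>verts G. strict_total_order (out_edges G v) (edge_ord G v)) \<and>
     strict_total_order (sources G) (src_ord G)"

(* The field edge_ord is a total function; its values outside the vertex set carry no
   information and are ignored here. *)
definition doag_iso :: "'v dograph \<Rightarrow> 'w dograph \<Rightarrow> bool" where
  "doag_iso G H \<longleftrightarrow>
     (\<exists>f. bij_betw f (verts G) (verts H) \<and>
          edges H = map_prod f f ` edges G \<and>
          (\<forall>v\<in>verts G. edge_ord H (f v) = map_prod (map_prod f f) (map_prod f f) ` edge_ord G v) \<and>
          src_ord H = map_prod f f ` src_ord G)"

(* A DOAG up to equality is an isomorphism class of graphs whose vertices are taken from nat;
   since vertex sets are finite, every class has such representatives. *)
definition doag_eq :: "nat dograph rel" where
  "doag_eq = {(G, H). is_doag G \<and> is_doag H \<and> doag_iso G H}"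

definition doag_class :: "nat dograph \<Rightarrow> nat dograph set" where
  "doag_class G = doag_eq `` {G}"

definition doags :: "nat \<Rightarrow> nat \<Rightarrow> nat \<Rightarrow> nat dograph set set" where
  "doags n m k =
     {G. is_doag G \<and> card (verts G) = n \<and> card (edges G) = m \<and> card (sources G) = k} // doag_eq"

definition D :: "nat \<Rightarrow> nat \<Rightarrow> nat \<Rightarrow> nat" where
  "D n m k = card (doags n m k)"


section \<open>Choosing the pair (p, i)\<close>

(* Pairs with p > m are omitted: for them m - p is negative, so the term is 0. *)
definition lex_pairs :: "nat \<Rightarrow> (nat \<times> nat) list" where
  "lex_pairs m = concat (map (\<lambda>p. map (\<lambda>i. (p, i)) [0..<Suc p]) [0..<Suc m])"

(* The truncated difference n + i - (k + p) stands for n - k - p + i.  If the latter is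
   negative, then k - 1 + p - i exceeds n - 1 and the factor D vanishes. *)
definition T :: "nat \<Rightarrow> nat \<Rightarrow> nat \<Rightarrow> nat \<Rightarrow> nat \<Rightarrow> nat" where
  "T n m k p i =
     D (n - 1) (m - p) (k - 1 + p - i) * ((n + i - (k + p)) choose i) * (p choose i) * fact i"

(* Computations on integers that count their multiplications in a state of type nat.  An exact
   division is counted like a multiplication. *)
type_synonym 'a counted = "(nat, 'a) state"

definition mul :: "nat \<Rightarrow> nat \<Rightarrow> nat counted" where
  "mul x y = State (\<lambda>q. (x * y, Suc q))"

definition exact_div :: "nat \<Rightarrow> nat \<Rightarrow> nat counted" where
  "exact_div x y = State (\<lambda>q. (x div y, Suc q))"

(* The cofactor of D in T n m k p i.  It is 1 for i = 0 and is otherwise obtained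
   from the cofactor c for the preceding pair (p, i - 1). *)
definition next_cofactor :: "nat \<Rightarrow> nat \<Rightarrow> nat \<Rightarrow> nat \<Rightarrow> nat \<Rightarrow> nat counted" where
  "next_cofactor n k p i c =
     (if i = 0 then State_Monad.return 1
      else do {
        a \<leftarrow> mul c (n + i - (k + p));
        b \<leftarrow> mul a (p - (i - 1));
        exact_div b i
      })"

definition term_value :: "nat \<Rightarrow> nat \<Rightarrow> nat \<Rightarrow> nat \<Rightarrow> nat \<Rightarrow> nat \<Rightarrow> nat counted" where
  "term_value n m k p i c =
     (let d = D (n - 1) (m - p) (k - 1 + p - i)
      in if i = 0 then State_Monad.return d else mul d c)"

(* S is the sum of the terms already seen and c the cofactor of the last of them.  The list is
   never exhausted when r < D n m k and n > 1, since the terms then sum up to D n m k. *)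
primrec scan ::
  "nat \<Rightarrow> nat \<Rightarrow> nat \<Rightarrow> nat \<Rightarrow> (nat \<times> nat) list \<Rightarrow> nat \<Rightarrow> nat \<Rightarrow> (nat \<times> nat) counted" where
  "scan n m k r [] S c = State_Monad.return undefined"
| "scan n m k r (x # xs) S c =
     (case x of (p, i) \<Rightarrow> do {
        c' \<leftarrow> next_cofactor n k p i c;
        t \<leftarrow> term_value n m k p i c';
        if r < S + t then State_Monad.return (p, i) else scan n m k r xs (S + t) c'
      })"

definition pick_pair :: "nat \<Rightarrow> nat \<Rightarrow> nat \<Rightarrow> nat \<Rightarrow> (nat \<times> nat) counted" where
  "pick_pair n m k r = scan n m k r (lex_pairs m) 0 1"

text \<open>The counted search returns the first pair at which the partial sum of the terms
  \<^const>\<open>T\<close> exceeds \<open>r\<close>.\<close>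

primrec scan_spec :: "(nat \<Rightarrow> nat \<Rightarrow> nat) \<Rightarrow> nat \<Rightarrow> (nat \<times> nat) list \<Rightarrow> nat \<Rightarrow> nat \<times> nat" where
  "scan_spec t r [] S = undefined"
| "scan_spec t r (x # xs) S =
     (case x of (p, i) \<Rightarrow> if r < S + t p i then (p, i) else scan_spec t r xs (S + t p i))"

definition cofactor :: "nat \<Rightarrow> nat \<Rightarrow> nat \<Rightarrow> nat \<Rightarrow> nat" where
  "cofactor n k p i = ((n + i - (k + p)) choose i) * (p choose i) * fact i"

lemma cofactor_0 [simp]: "cofactor n k p 0 = 1"
  by (simp add: cofactor_def)

lemma cofactor_Suc:
  "cofactor n k p i * (n + Suc i - (k + p)) * (p - i) div Suc i = cofactor n k p (Suc i)"
proof -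
  have p: "(p choose Suc i) * Suc i = (p choose i) * (p - i)"
    by (metis binomial_absorb_comp mult.commute times_binomial_minus1_eq Suc_times_binomial_eq
        binomial_absorption)
  have N: "((n + Suc i - (k + p)) choose Suc i) * Suc i =
      ((n + i - (k + p)) choose i) * (n + Suc i - (k + p))"
  proof (cases "k + p \<le> n + i")
    case True
    then have "n + Suc i - (k + p) = Suc (n + i - (k + p))" by simp
    then show ?thesis using Suc_times_binomial_eq[of "n + i - (k + p)" i] by (simp add: mult.commute)
  next
    case False
    then show ?thesis by simp
  qed
  have "cofactor n k p i * (n + Suc i - (k + p)) * (p - i)
      = (((n + i - (k + p)) choose i) * (n + Suc i - (k + p))) * ((p choose i) * (p - i)) * fact i"
    by (simp add: cofactor_def)
  also have "\<dots> = cofactor n k p (Suc i) * Suc i"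
    unfolding N[symmetric] p[symmetric] by (simp add: cofactor_def algebra_simps)
  finally show ?thesis by (simp only: nonzero_mult_div_cancel_right nat.distinct not_False_eq_True)
qed

lemma run_next_cofactor:
  assumes "i = 0 \<or> c = cofactor n k p (i - 1)"
  shows "fst (run_state (next_cofactor n k p i c) q) = cofactor n k p i"
proof (cases i)
  case (Suc j)
  with assms show ?thesis using cofactor_Suc[of n k p j]
    by (simp add: next_cofactor_def mul_def exact_div_def)
qed (simp add: next_cofactor_def)

lemma run_term_value:
  "fst (run_state (term_value n m k p i (cofactor n k p i)) q) = T n m k p i"
  by (simp add: term_value_def mul_def T_def cofactor_def Let_def mult.assoc)

definition lex_step :: "nat \<times> nat \<Rightarrow> nat \<times> nat \<Rightarrow> bool" where
  "lex_step x y \<longleftrightarrow> snd y = 0 \<or> y = (fst x, Suc (snd x))"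

lemma fst_run_scan:
  assumes "successively lex_step xs"
    and "xs \<noteq> [] \<Longrightarrow> snd (hd xs) = 0 \<or> c = cofactor n k (fst (hd xs)) (snd (hd xs) - 1)"
  shows "fst (run_state (scan n m k r xs S c) q) = scan_spec (T n m k) r xs S"
  using assms
proof (induction xs arbitrary: S c q)
  case (Cons x xs)
  obtain p i where x: "x = (p, i)" by fastforce
  obtain c' q1 where 1: "run_state (next_cofactor n k p i c) q = (c', q1)" by fastforce
  have c': "c' = cofactor n k p i"
    using run_next_cofactor[of i c n k p q] Cons.prems(2) 1 x by simp
  obtain t q2 where 2: "run_state (term_value n m k p i c') q1 = (t, q2)" by fastforce
  have t: "t = T n m k p i"
    using run_term_value[of n m k p i q1] 2 c' by simp
  have "fst (run_state (scan n m k r xs (S + t) c') q2) = scan_spec (T n m k) r xs (S + t)"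
  proof (rule Cons.IH)
    show "successively lex_step xs" using Cons.prems(1) by (cases xs) auto
    assume "xs \<noteq> []"
    then show "snd (hd xs) = 0 \<or> c' = cofactor n k (fst (hd xs)) (snd (hd xs) - 1)"
      using Cons.prems(1) x c' by (cases xs) (auto simp: lex_step_def)
  qed
  then show ?case using x 1 2 t by simp
qed simp

lemma successively_lex_pairs: "successively lex_step (lex_pairs m)"
proof -
  have row: "successively lex_step (map (\<lambda>i. (p, i)) [0..<l])" for p l
    by (induction l) (auto simp: successively_append_iff lex_step_def last_map)
  have hd_row: "hd (map (\<lambda>i. (p, i)) [0..<Suc p]) = (p, 0)" for p :: nat
    by (simp add: hd_map del: upt_Suc)
  have "successively lex_step (concat (map (\<lambda>p. map (\<lambda>i. (p, i)) [0..<Suc p]) [0..<l]))" for l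
  proof (induction l)
    case (Suc l)
    then show ?case using row[of l "Suc l"] hd_row[of l]
      by (auto simp: successively_append_iff lex_step_def simp del: upt_Suc simp: upt_Suc_append)
  qed simp
  then show ?thesis unfolding lex_pairs_def by blast
qed

lemma fst_run_pick_pair:
  "fst (run_state (pick_pair n m k r) q) = scan_spec (T n m k) r (lex_pairs m) 0"
  unfolding pick_pair_def
proof (rule fst_run_scan[OF successively_lex_pairs])
  show "snd (hd (lex_pairs m)) = 0 \<or>
      1 = cofactor n k (fst (hd (lex_pairs m))) (snd (hd (lex_pairs m)) - 1)"
    by (simp add: lex_pairs_def upt_conv_Cons del: upt_Suc)
qed


section \<open>The sampler\<close>

definition source_list :: "'v dograph \<Rightarrow> 'v list" where
  "source_list G =
     (THE xs. set xs = sources G \<and> distinct xs \<and> sorted_wrt (\<lambda>x y. (x, y) \<in> src_ord G) xs)"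

definition largest_sources :: "nat \<Rightarrow> 'v dograph \<Rightarrow> 'v list" where
  "largest_sources s G = drop (length (source_list G) - s) (source_list G)"

definition add_source :: "'v \<Rightarrow> 'v list \<Rightarrow> 'v dograph \<Rightarrow> 'v dograph" where
  "add_source x E G =
     (let R = sources G - set E in
      \<lparr> verts = insert x (verts G),
        edges = edges G \<union> {x} \<times> set E,
        edge_ord = (edge_ord G)
          (x := {((x, E ! a), (x, E ! b)) | a b. a < b \<and> b < length E}),
        src_ord = {x} \<times> R \<union> (src_ord G \<inter> R \<times> R) \<rparr>)"

definition single_vertex :: "nat dograph" where
  "single_vertex = \<lparr> verts = {0}, edges = {}, edge_ord = (\<lambda>_. {}), src_ord = {} \<rparr>"

(* The second component of the result is the number of multiplications.  The graph
   returned for n has the vertices 0, ..., n - 1; the vertex added last is n - 1.  There is no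
   equation for n = 0, where the procedure is meaningless. *)
fun UnifDOAG :: "nat \<Rightarrow> nat \<Rightarrow> nat \<Rightarrow> (nat dograph \<times> nat) pmf" where
  "UnifDOAG (Suc 0) m k = return_pmf (single_vertex, 0)"
| "UnifDOAG (Suc (Suc l)) m k =
     do {
       r \<leftarrow> pmf_of_set {0..<D (Suc (Suc l)) m k};
       let ((p, i), q) = run_state (pick_pair (Suc (Suc l)) m k r) 0;
       (G, q') \<leftarrow> UnifDOAG (Suc l) (m - p) (k - 1 + p - i);
       I \<leftarrow> pmf_of_set {I. I \<subseteq> verts G - sources G \<and> card I = i};
       xs \<leftarrow> pmf_of_set (permutations_of_set I);
       E \<leftarrow> pmf_of_set (shuffles xs (largest_sources (p - i) G));
       return_pmf (add_source (Suc l) E G, q + q')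
     }"

end

theory Submission
  imports Defs
begin

text \<open>Deleting the smallest source \<open>x\<close> of a DOAG with at least two vertices yields a smaller DOAG \<open>H\<close>,
  once the children of \<open>x\<close> that become sources are placed after the old sources in the order of
  the edges of \<open>x\<close>; so \<open>x\<close> points to the \<open>p - i\<close> largest sources of \<open>H\<close>, in order, interleaved with
  \<open>i\<close> non-sources.  A DOAG has no nontrivial automorphism, because its sources are fixed by their
  order and every fixed vertex fixes its children.  Hence, whatever representative of the class of
  \<open>H\<close> has been drawn, exactly one list of targets produces a given class, and all representatives
  admit the same number \<open>T n m k p i / D (n - 1) (m - p) (k - 1 + p - i)\<close> of lists.  This gives both
  \<open>D n m k = (\<Sum>(p, i). T n m k p i)\<close> and the uniformity.  For the cost, a pair with \<open>i = 0\<close> needs no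
  multiplication and any other pair needs four, so that the search stopping at out-degree \<open>p\<close>
  performs at most \<open>4 p\<^sup>2\<close> of them.\<close>

section \<open>Strict orders of lists and isomorphisms\<close>

text \<open>Every order is handled as a list: an order on a finite set is \<open>list_rel xs\<close>
  for exactly one distinct \<open>xs\<close>, isomorphisms act on such lists by \<open>map\<close>,
  and equality of orders becomes equality of lists. The obstacle is that the sampler works with
  concrete graphs while uniformity concerns classes. The induction hypothesis says nothing about how
  the representatives of one class are distributed, and the set of admissible lists changes with the
  representative. So everything that enters a probability has to be a function of the class alone,
  which is why the statements on extensions quantify over all graphs and all new vertices. Rigidity
  is essential here: a nontrivial automorphism of the smaller graph could make several lists produce
  the same class, and the terms of the recurrence would overcount.\<close>

primrec list_rel :: "'a list \<Rightarrow> 'a rel" where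
  "list_rel [] = {}"
| "list_rel (x # xs) = {x} \<times> set xs \<union> list_rel xs"

lemma list_rel_subset: "list_rel xs \<subseteq> set xs \<times> set xs"
  by (induction xs) auto

lemma list_rel_map: "list_rel (map f xs) = map_prod f f ` list_rel xs"
  by (induction xs) (auto simp: image_Un)

lemma list_rel_filter: "list_rel (filter P xs) = list_rel xs \<inter> Collect P \<times> Collect P"
  using list_rel_subset by (induction xs) auto

text \<open>Links the recursive form, which suits induction, to the index form in which
  \<open>add_source\<close> gives the order of the new edges.\<close>

lemma list_rel_nth: "list_rel xs = {(xs ! a, xs ! b) | a b. a < b \<and> b < length xs}"
proof (induction xs)
  case (Cons x xs)
  show ?case
  proof (intro set_eqI iffI)
    fix z assume "z \<in> list_rel (x # xs)"
    then consider y where "z = (x, y)" "y \<in> set xs" | "z \<in> list_rel xs" by auto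
    then show "z \<in> {((x # xs) ! a, (x # xs) ! b) | a b. a < b \<and> b < length (x # xs)}"
    proof cases
      case 1
      then obtain b where "b < length xs" "y = xs ! b" by (auto simp: in_set_conv_nth)
      then have "z = ((x # xs) ! 0, (x # xs) ! Suc b) \<and> 0 < Suc b \<and> Suc b < length (x # xs)"
        using 1 by simp
      then show ?thesis by blast
    next
      case 2
      then obtain a b where "z = (xs ! a, xs ! b)" "a < b" "b < length xs" using Cons by auto
      then have "z = ((x # xs) ! Suc a, (x # xs) ! Suc b) \<and> Suc a < Suc b \<and>
          Suc b < length (x # xs)" by simp
      then show ?thesis by blast
    qed
  next
    fix z assume "z \<in> {((x # xs) ! a, (x # xs) ! b) | a b. a < b \<and> b < length (x # xs)}"
    then obtain a b where z: "z = ((x # xs) ! a, (x # xs) ! b)" "a < b" "b < length (x # xs)"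
      by blast
    then obtain b' where b': "b = Suc b'" by (cases b) auto
    show "z \<in> list_rel (x # xs)"
    proof (cases a)
      case 0
      then show ?thesis using z b' by auto
    next
      case (Suc a')
      then show ?thesis using z b' Cons by auto
    qed
  qed
qed simp

lemma sorted_wrt_iff_list_rel: "sorted_wrt (\<lambda>x y. (x, y) \<in> r) xs \<longleftrightarrow> list_rel xs \<subseteq> r"
  by (induction xs) auto

text \<open>Inclusion suffices, since a strict total order cannot be enlarged on the same set. The
  weak hypothesis is the one available for \<open>source_list\<close>, whose definition only asks
  for a sorted list, that is, \<open>list_rel xs \<subseteq> src_ord G\<close>.\<close>

lemma list_rel_inject:
  assumes "distinct xs" "distinct ys" "set xs = set ys" "list_rel xs \<subseteq> list_rel ys"
  shows "xs = ys"
  using assms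
proof (induction xs arbitrary: ys)
  case (Cons x xs)
  obtain y ys' where ys: "ys = y # ys'" using Cons.prems(3) by (cases ys) auto
  \<comment> \<open>Otherwise \<open>y\<close> lies in the tail of \<open>x # xs\<close> and so
    comes after \<open>x\<close>, although it is the first entry of \<open>ys\<close>.\<close>
  have [simp]: "x = y"
  proof (rule ccontr)
    assume "x \<noteq> y"
    then have "y \<in> set xs" using Cons.prems(3) ys by auto
    then have "(x, y) \<in> list_rel ys" using Cons.prems(4) by auto
    then show False using \<open>x \<noteq> y\<close> ys Cons.prems(2) list_rel_subset[of ys'] by auto
  qed
  have "set xs = set ys'" using Cons.prems(1-3) ys by auto
  moreover have "list_rel xs \<subseteq> list_rel ys'"
  proof
    fix z assume z: "z \<in> list_rel xs"
    then have "fst z \<noteq> x" using Cons.prems(1) list_rel_subset[of xs] by auto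
    then show "z \<in> list_rel ys'" using z Cons.prems(4) ys by auto
  qed
  ultimately have "xs = ys'" using Cons.IH[of ys'] Cons.prems(1,2) ys by simp
  then show ?case using ys by simp
qed simp

lemma strict_total_order_list_rel:
  assumes "distinct xs"
  shows "strict_total_order (set xs) (list_rel xs)"
proof -
  have "trans (list_rel xs)"
    using assms
  proof (induction xs)
    case (Cons x xs)
    then show ?case using list_rel_subset[of xs] unfolding trans_def by simp blast
  qed simp
  moreover have "irrefl (list_rel xs)"
    using assms by (induction xs) (auto simp: irrefl_def)
  moreover have "total_on (set xs) (list_rel xs)"
    by (induction xs) (auto simp: total_on_def)
  ultimately show ?thesis
    by (simp add: strict_total_order_def strict_linear_order_on_def list_rel_subset)
qed

text \<open>A finite transitive irreflexive relation is well-founded, so totality yields a least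
  element; it becomes the head of the list, and the rest follows by induction on the size of
  \<open>A\<close>.\<close>

lemma strict_total_order_eq_list_rel:
  assumes "finite A" "strict_total_order A r"
  shows "\<exists>xs. distinct xs \<and> set xs = A \<and> r = list_rel xs"
  using assms
proof (induction "card A" arbitrary: A r)
  case 0
  then show ?case by (auto simp: strict_total_order_def)
next
  case (Suc n)
  have r: "trans r" "irrefl r" "total_on A r" "r \<subseteq> A \<times> A"
    using Suc.prems by (auto simp: strict_total_order_def strict_linear_order_on_def)
  have "acyclic r" using r by (simp add: acyclic_irrefl)
  moreover have "finite r" using r Suc.prems finite_subset by blast
  ultimately have "wf r" by (rule finite_acyclic_wf[rotated])
  moreover obtain a where "a \<in> A" using Suc.hyps by (metis card.empty ex_in_conv nat.distinct(1))
  ultimately obtain x where x: "x \<in> A" "\<And>y. (y, x) \<in> r \<Longrightarrow> y \<notin> A" by (metis wfE_min)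
  let ?r = "r \<inter> (A - {x}) \<times> (A - {x})"
  have sto: "strict_total_order (A - {x}) ?r"
    using r by (auto simp: strict_total_order_def strict_linear_order_on_def total_on_def irrefl_def
        intro!: transI dest: transD)
  have n: "n = card (A - {x})" using Suc.hyps(2) Suc.prems(1) x(1) by simp
  obtain xs where xs: "distinct xs" "set xs = A - {x}" "?r = list_rel xs"
    using Suc.hyps(1)[OF n _ sto] Suc.prems(1) by blast
  have min1: "(b, x) \<notin> r" for b using r(4) x(2) by blast
  have min: "(x, b) \<in> r \<longleftrightarrow> b \<in> A - {x}" for b
    using r(4) min1[of b] min1[of x] r(3) x(1) by (auto simp: total_on_def)
  have "(a, b) \<in> r \<longleftrightarrow> (a, b) \<in> {x} \<times> (A - {x}) \<union> ?r" for a b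
    using r(4) min[of b] min1[of a] by (cases "a = x") auto
  then have "r = {x} \<times> (A - {x}) \<union> ?r" by (intro set_eqI) (simp only: split_paired_all)
  also have "\<dots> = list_rel (x # xs)" by (simp only: list_rel.simps xs)
  finally have "r = list_rel (x # xs)" .
  then show ?case using xs(1,2) x(1) by (intro exI[of _ "x # xs"]) auto
qed

section \<open>Isomorphisms and rigidity\<close>

text \<open>Exposes the bijection that \<open>doag_iso\<close> quantifies away: the proof composes,
  inverts and compares such maps.\<close>

definition dograph_iso :: "('v \<Rightarrow> 'w) \<Rightarrow> 'v dograph \<Rightarrow> 'w dograph \<Rightarrow> bool" where
  "dograph_iso f G H \<longleftrightarrow>
     bij_betw f (verts G) (verts H) \<and>
     edges H = map_prod f f ` edges G \<and>
     (\<forall>v\<in>verts G. edge_ord H (f v) = map_prod (map_prod f f) (map_prod f f) ` edge_ord G v) \<and>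
     src_ord H = map_prod f f ` src_ord G"

lemma doag_iso_iff: "doag_iso G H \<longleftrightarrow> (\<exists>f. dograph_iso f G H)"
  by (simp add: doag_iso_def dograph_iso_def)

lemma is_doagD:
  assumes "is_doag G"
  shows "finite (verts G)" "edges G \<subseteq> verts G \<times> verts G" "acyclic (edges G)"
    "finite (edges G)" "wf (edges G)" "finite (sources G)" "sources G \<subseteq> verts G"
    "strict_total_order (sources G) (src_ord G)"
    "\<And>v. v \<in> verts G \<Longrightarrow> strict_total_order (out_edges G v) (edge_ord G v)"
proof -
  show *: "finite (verts G)" "edges G \<subseteq> verts G \<times> verts G" "acyclic (edges G)"
    "strict_total_order (sources G) (src_ord G)"
    "\<And>v. v \<in> verts G \<Longrightarrow> strict_total_order (out_edges G v) (edge_ord G v)"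
    using assms by (auto simp: is_doag_def)
  show "finite (edges G)" using * finite_subset by blast
  then show "wf (edges G)" using * finite_acyclic_wf by blast
  show "sources G \<subseteq> verts G" by (auto simp: sources_def)
  then show "finite (sources G)" using * finite_subset by blast
qed

text \<open>The definite description is unambiguous by \<open>list_rel_inject\<close>.\<close>

lemma source_listI:
  assumes "distinct xs" "set xs = sources G" "src_ord G = list_rel xs"
  shows "source_list G = xs"
  unfolding source_list_def
proof (rule the_equality)
  fix ys
  assume "set ys = sources G \<and> distinct ys \<and> sorted_wrt (\<lambda>x y. (x, y) \<in> src_ord G) ys"
  then show "ys = xs" using assms by (intro list_rel_inject) (simp_all add: sorted_wrt_iff_list_rel)
qed (simp add: assms sorted_wrt_iff_list_rel)

lemma source_list:
  assumes "is_doag G"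
  shows "distinct (source_list G)" "set (source_list G) = sources G"
    "src_ord G = list_rel (source_list G)"
proof -
  obtain xs where xs: "distinct xs" "set xs = sources G" "src_ord G = list_rel xs"
    using strict_total_order_eq_list_rel[OF is_doagD(6,8)[OF assms]] by blast
  then show "distinct (source_list G)" "set (source_list G) = sources G"
    "src_ord G = list_rel (source_list G)"
    by (simp_all add: source_listI[OF xs])
qed

lemma length_source_list: "is_doag G \<Longrightarrow> length (source_list G) = card (sources G)"
  by (metis distinct_card source_list(1,2))

text \<open>The edges leaving \<open>v\<close> share their first end, so their order amounts to a
  list of targets, the form in which \<open>add_source\<close> takes it.\<close>

lemma out_list_exists:
  assumes "is_doag G" "v \<in> verts G"
  obtains L where "distinct L" "set L = edges G `` {v}" "edge_ord G v = list_rel (map (Pair v) L)"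
proof -
  have "finite (out_edges G v)" using is_doagD(4)[OF assms(1)] by (simp add: out_edges_def)
  then obtain M where M: "distinct M" "set M = out_edges G v" "edge_ord G v = list_rel M"
    using strict_total_order_eq_list_rel is_doagD(9)[OF assms] by blast
  have eq: "map (Pair v) (map snd M) = M"
    using M(2) by (auto simp: out_edges_def intro!: map_idI)
  then have "distinct (map snd M)" using M(1) by (metis distinct_map)
  moreover have "set (map snd M) = edges G `` {v}" using M(2) by (force simp: out_edges_def)
  ultimately show ?thesis using that M(3) eq by metis
qed

lemma out_edges_eq: "out_edges G v = Pair v ` (edges G `` {v})"
  by (auto simp: out_edges_def)

lemma out_degree_eq: "out_degree G v = card (edges G `` {v})"
  by (simp add: out_degree_def out_edges_eq card_image inj_on_def)

text \<open>Speaks of vertices and edges alone, because \<open>iso_add_source_cancel\<close> needs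
  it before the orders are known to be preserved.\<close>

lemma sources_image:
  assumes bij: "bij_betw f (verts G) (verts H)" and E: "edges H = map_prod f f ` edges G"
    and G: "edges G \<subseteq> verts G \<times> verts G"
  shows "sources H = f ` sources G"
proof -
  have inj: "inj_on f (verts G)" and im: "verts H = f ` verts G"
    using bij by (auto simp: bij_betw_def)
  have "f v \<in> sources H \<longleftrightarrow> v \<in> sources G" if "v \<in> verts G" for v
  proof -
    have "(\<exists>u. (u, f v) \<in> edges H) \<longleftrightarrow> (\<exists>u. (u, v) \<in> edges G)"
    proof
      assume "\<exists>u. (u, f v) \<in> edges H"
      then obtain a b where ab: "(a, b) \<in> edges G" "f v = f b" using E by auto
      then have "b = v" using inj G that by (auto simp: inj_on_def)
      then show "\<exists>u. (u, v) \<in> edges G" using ab by auto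
    next
      assume "\<exists>u. (u, v) \<in> edges G"
      then show "\<exists>u. (u, f v) \<in> edges H" using E by force
    qed
    then show ?thesis using that im by (auto simp: sources_def)
  qed
  then show ?thesis using im by (auto simp: sources_def)
qed

lemma iso_sources: "dograph_iso f G H \<Longrightarrow> is_doag G \<Longrightarrow> sources H = f ` sources G"
  using sources_image[of f G H] is_doagD(2)[of G] by (simp add: dograph_iso_def)

lemma iso_source_list:
  assumes "dograph_iso f G H" "is_doag G"
  shows "source_list H = map f (source_list G)"
proof (rule source_listI)
  have "inj_on f (sources G)"
    using assms(1) is_doagD(7)[OF assms(2)] by (auto simp: dograph_iso_def bij_betw_def inj_on_subset)
  then show "distinct (map f (source_list G))" by (simp add: distinct_map source_list assms(2))
  show "set (map f (source_list G)) = sources H"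
    using assms by (simp add: iso_sources source_list)
  show "src_ord H = list_rel (map f (source_list G))"
    using assms by (simp add: list_rel_map dograph_iso_def source_list(3))
qed

lemma iso_refl: "dograph_iso id G G"
  by (simp add: dograph_iso_def map_prod.id)

lemma iso_comp:
  assumes "dograph_iso f G H" "dograph_iso g H K"
  shows "dograph_iso (g \<circ> f) G K"
  unfolding dograph_iso_def
proof (intro conjI ballI)
  show "bij_betw (g \<circ> f) (verts G) (verts K)"
    using assms by (auto simp: dograph_iso_def intro: bij_betw_trans)
  fix v assume v: "v \<in> verts G"
  then have "f v \<in> verts H" using assms(1) by (auto simp: dograph_iso_def bij_betw_def)
  then have "edge_ord K (g (f v)) =
      map_prod (map_prod g g) (map_prod g g) ` map_prod (map_prod f f) (map_prod f f) ` edge_ord G v"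
    using assms v by (simp add: dograph_iso_def)
  then show "edge_ord K ((g \<circ> f) v) =
      map_prod (map_prod (g \<circ> f) (g \<circ> f)) (map_prod (g \<circ> f) (g \<circ> f)) ` edge_ord G v"
    by (simp only: image_comp map_prod.comp o_apply)
next
  have "edges K = map_prod g g ` map_prod f f ` edges G" using assms by (simp add: dograph_iso_def)
  then show "edges K = map_prod (g \<circ> f) (g \<circ> f) ` edges G"
    by (simp only: image_comp map_prod.comp)
next
  have "src_ord K = map_prod g g ` map_prod f f ` src_ord G" using assms by (simp add: dograph_iso_def)
  then show "src_ord K = map_prod (g \<circ> f) (g \<circ> f) ` src_ord G"
    by (simp only: image_comp map_prod.comp)
qed

lemma iso_the_inv_into:
  assumes "dograph_iso f G H" "is_doag G"
  shows "dograph_iso (the_inv_into (verts G) f) H G"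
proof -
  let ?g = "the_inv_into (verts G) f"
  have bij: "bij_betw f (verts G) (verts H)" using assms(1) by (simp add: dograph_iso_def)
  then have inv: "?g (f v) = v" if "v \<in> verts G" for v
    using that by (simp add: bij_betw_def the_inv_into_f_f)
  \<comment> \<open>The two maps cancel only on vertices of \<open>G\<close>, so images can be
    undone only for relations living on the vertices (here) or on the edges
    (\<open>im4\<close>).\<close>
  have im2: "map_prod ?g ?g ` map_prod f f ` A = A" if "A \<subseteq> verts G \<times> verts G" for A
  proof -
    have "map_prod ?g ?g (map_prod f f z) = z" if "z \<in> A" for z
      using that \<open>A \<subseteq> _\<close> inv by (cases z) auto
    then show ?thesis by (simp add: image_comp cong: image_cong)
  qed
  have im4: "map_prod (map_prod ?g ?g) (map_prod ?g ?g) ` map_prod (map_prod f f) (map_prod f f) ` A = A"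
    if "A \<subseteq> edges G \<times> edges G" for A
  proof -
    have "map_prod (map_prod ?g ?g) (map_prod ?g ?g) (map_prod (map_prod f f) (map_prod f f) z) = z"
      if "z \<in> A" for z
    proof -
      have "z \<in> edges G \<times> edges G" using that \<open>A \<subseteq> _\<close> by blast
      then have "fst z \<in> verts G \<times> verts G" "snd z \<in> verts G \<times> verts G"
        using is_doagD(2)[OF assms(2)] by auto
      then show ?thesis using inv by (cases z) force
    qed
    then show ?thesis by (simp add: image_comp cong: image_cong)
  qed
  have ord: "edge_ord G v \<subseteq> edges G \<times> edges G" if "v \<in> verts G" for v
    using is_doagD(9)[OF assms(2) that] by (auto simp: strict_total_order_def out_edges_def)
  have src: "src_ord G \<subseteq> verts G \<times> verts G"
    using is_doagD(7,8)[OF assms(2)] by (auto simp: strict_total_order_def)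
  show ?thesis
    unfolding dograph_iso_def
  proof (intro conjI ballI)
    show "bij_betw ?g (verts H) (verts G)" using bij by (rule bij_betw_the_inv_into)
    fix w assume "w \<in> verts H"
    then obtain v where v: "v \<in> verts G" "w = f v" using bij by (auto simp: bij_betw_def)
    then have "edge_ord H w = map_prod (map_prod f f) (map_prod f f) ` edge_ord G v"
      using assms(1) by (simp add: dograph_iso_def)
    then show "edge_ord G (?g w) = map_prod (map_prod ?g ?g) (map_prod ?g ?g) ` edge_ord H w"
      using im4[OF ord[OF v(1)]] inv[OF v(1)] v(2) by simp
  next
    have "edges H = map_prod f f ` edges G" using assms(1) by (simp only: dograph_iso_def)
    then show "edges G = map_prod ?g ?g ` edges H" by (simp only: im2[OF is_doagD(2)[OF assms(2)]])
  next
    have "src_ord H = map_prod f f ` src_ord G" using assms(1) by (simp only: dograph_iso_def)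
    then show "src_ord G = map_prod ?g ?g ` src_ord H" by (simp only: im2[OF src])
  qed
qed

text \<open>Both lists enumerate the children of \<open>f v\<close> and induce the same order on the
  edges there, so \<open>list_rel_inject\<close> identifies them.\<close>

lemma iso_out_list:
  assumes "dograph_iso f G H" "is_doag G" "v \<in> verts G"
    "distinct L" "set L = edges G `` {v}" "edge_ord G v = list_rel (map (Pair v) L)"
    "distinct M" "set M = edges H `` {f v}" "edge_ord H (f v) = list_rel (map (Pair (f v)) M)"
  shows "M = map f L"
proof -
  have fin: "set L \<subseteq> verts G" using assms(5) is_doagD(2)[OF assms(2)] by auto
  have inj: "inj_on f (verts G)" using assms(1) by (auto simp: dograph_iso_def bij_betw_def)
  have "set M = f ` set L"
  proof -
    have "set M = (map_prod f f ` edges G) `` {f v}" using assms(1,8) by (simp add: dograph_iso_def)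
    also have "\<dots> = f ` (edges G `` {v})"
    proof -
      have "a = v" if "(a, b) \<in> edges G" "f a = f v" for a b
        using that inj_onD[OF inj] assms(3) is_doagD(2)[OF assms(2)] by blast
      then show ?thesis by force
    qed
    finally show ?thesis by (simp add: assms(5))
  qed
  moreover have "list_rel (map (Pair (f v)) M) = list_rel (map (Pair (f v)) (map f L))"
  proof -
    have "edge_ord H (f v) = map_prod (map_prod f f) (map_prod f f) ` edge_ord G v"
      using assms(1,3) by (simp add: dograph_iso_def)
    also have "\<dots> = list_rel (map (map_prod f f) (map (Pair v) L))"
      by (simp only: list_rel_map assms(6))
    also have "map (map_prod f f) (map (Pair v) L) = map (Pair (f v)) (map f L)" by simp
    finally show ?thesis using assms(9) by simp
  qed
  moreover have "distinct (map f L)"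
    using assms(4) fin inj by (auto simp: distinct_map inj_on_subset)
  moreover have "distinct (map (Pair a) xs) \<longleftrightarrow> distinct xs" for a :: 'b and xs :: "'b list"
    by (simp add: distinct_map inj_on_def)
  ultimately have "map (Pair (f v)) M = map (Pair (f v)) (map f L)"
    using assms(7) by (intro list_rel_inject) (simp_all only: set_map subset_refl)
  then show ?thesis by (rule map_injective) (simp add: inj_def)
qed

lemma map_eq_selfD: "map f xs = xs \<Longrightarrow> x \<in> set xs \<Longrightarrow> f x = x"
  by (induction xs) auto

lemma iso_self_trivial:
  assumes "dograph_iso f G G" "is_doag G" "v \<in> verts G"
  shows "f v = v"
  using is_doagD(5)[OF assms(2)] assms(3)
proof (induction v)
  case (less v)
  show ?case
  proof (cases "v \<in> sources G")
    case True
    have "map f (source_list G) = source_list G" using iso_source_list[OF assms(1,2)] by simp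
    then show ?thesis using True source_list(2)[OF assms(2)] map_eq_selfD by metis
  next
    case False
    then obtain u where u: "(u, v) \<in> edges G" using less.prems by (auto simp: sources_def)
    then have uv: "u \<in> verts G" using is_doagD(2)[OF assms(2)] by auto
    obtain L where L: "distinct L" "set L = edges G `` {u}" "edge_ord G u = list_rel (map (Pair u) L)"
      using out_list_exists[OF assms(2) uv] by blast
    have "f u = u" using less.IH u uv by blast
    then have "L = map f L" using iso_out_list[OF assms(1,2) uv L, of L] L by simp
    moreover have "v \<in> set L" using L u by simp
    ultimately show ?thesis by (metis map_eq_selfD)
  qed
qed


section \<open>Adding and removing the smallest source\<close>

text \<open>These are the target lists for which the sources of \<open>G\<close> that \<^const>\<open>add_source\<close> turns into
  non-sources are the largest ones, listed in increasing order; \<open>G\<close> is then recovered by deleting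
  the new vertex.\<close>

definition valid_targets :: "'v dograph \<Rightarrow> 'v list \<Rightarrow> bool" where
  "valid_targets G E \<longleftrightarrow> distinct E \<and> set E \<subseteq> verts G \<and>
     (\<exists>L. source_list G = L @ filter (\<lambda>v. v \<in> sources G) E)"

lemma add_source_simps [simp]:
  "verts (add_source x E G) = insert x (verts G)"
  "edges (add_source x E G) = edges G \<union> {x} \<times> set E"
  "v \<noteq> x \<Longrightarrow> edge_ord (add_source x E G) v = edge_ord G v"
  by (simp_all add: add_source_def Let_def)

lemma edge_ord_add_source_new [simp]:
  "edge_ord (add_source x E G) x = list_rel (map (Pair x) E)"
proof -
  have "{((x, E ! a), (x, E ! b)) | a b. a < b \<and> b < length E} = list_rel (map (Pair x) E)"
    unfolding list_rel_map list_rel_nth[of E] by force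
  then show ?thesis by (simp add: add_source_def Let_def)
qed

lemma sources_add_source:
  assumes "edges G \<subseteq> verts G \<times> verts G" "set E \<subseteq> verts G" "x \<notin> verts G"
  shows "sources (add_source x E G) = insert x (sources G - set E)"
  using assms by (auto simp: sources_def)

text \<open>Deleting the members of \<open>E\<close> from the source list of \<open>G\<close> leaves
  exactly \<open>L\<close>; the new source order is therefore that of \<open>x # L\<close>, with the
  new vertex smallest.\<close>

lemma add_source_is_doag:
  assumes G: "is_doag G" and x: "x \<notin> verts G" and E: "distinct E" "set E \<subseteq> verts G"
    and L: "source_list G = L @ filter (\<lambda>v. v \<in> sources G) E"
  shows "is_doag (add_source x E G)" and "source_list (add_source x E G) = x # L"
proof -
  note GD = is_doagD[OF G]
  have sources: "sources (add_source x E G) = insert x (sources G - set E)"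
    by (rule sources_add_source[OF GD(2) E(2) x])
  have dist: "distinct (L @ filter (\<lambda>v. v \<in> sources G) E)"
    and set_eq: "set L \<union> (set E \<inter> sources G) = sources G"
    using source_list(1,2)[OF G] unfolding L by auto
  then have set_L: "set L = sources G - set E" by auto
  have dL: "distinct (x # L)" using dist set_L x GD(7) by auto
  have "filter (\<lambda>v. v \<notin> set E) L = L" using set_L by (simp add: filter_id_conv)
  moreover have "filter (\<lambda>v. v \<notin> set E) (filter (\<lambda>v. v \<in> sources G) E) = []"
    by (simp add: filter_empty_conv)
  ultimately have "filter (\<lambda>v. v \<notin> set E) (source_list G) = L" unfolding L by simp
  then have LR: "list_rel L = src_ord G \<inter> {v. v \<notin> set E} \<times> {v. v \<notin> set E}"
    using list_rel_filter[of "\<lambda>v. v \<notin> set E" "source_list G"] source_list(3)[OF G] by simp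
  have "src_ord G \<subseteq> sources G \<times> sources G"
    using list_rel_subset[of "source_list G"] source_list(2,3)[OF G] by simp
  then have src: "src_ord (add_source x E G) = list_rel (x # L)"
    unfolding list_rel.simps LR set_L by (auto simp: add_source_def Let_def)
  then show "source_list (add_source x E G) = x # L"
    using dL by (intro source_listI) (simp_all add: sources set_L)
  \<comment> \<open>Every new edge goes from rank 0 to rank 1, and no old edge ends in
    \<open>x\<close>; hence the union with the old edges stays well-founded.\<close>
  have "wf ({x} \<times> set E)"
    by (rule wf_subset[OF wf_inv_image[OF wf_less_than, of "\<lambda>v. if v = x then 0 else 1"]]) (use x E(2) in auto)
  then have "wf (edges G \<union> {x} \<times> set E)"
    using wf_Un[of "{x} \<times> set E" "edges G"] GD(2,5) x by (auto simp: Un_commute)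
  then have ac: "acyclic (edges G \<union> {x} \<times> set E)" by (rule wf_acyclic)
  have "strict_total_order (out_edges (add_source x E G) v) (edge_ord (add_source x E G) v)"
    if "v \<in> insert x (verts G)" for v
  proof (cases "v = x")
    case True
    have "out_edges (add_source x E G) x = set (map (Pair x) E)"
      using GD(2) x by (auto simp: out_edges_def)
    moreover have "distinct (map (Pair x) E)" using E by (simp add: distinct_map inj_on_def)
    ultimately show ?thesis using True strict_total_order_list_rel by (metis edge_ord_add_source_new)
  next
    case False
    then have "out_edges (add_source x E G) v = out_edges G v" by (auto simp: out_edges_def)
    then show ?thesis using GD(9)[of v] False that by simp
  qed
  moreover have "strict_total_order (sources (add_source x E G)) (src_ord (add_source x E G))"
    using strict_total_order_list_rel[OF dL] src by (simp add: sources set_L)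
  ultimately show "is_doag (add_source x E G)"
    using GD(1,2) E(2) ac by (auto simp: is_doag_def)
qed

text \<open>Carries an extension over to another representative: the target list moves along
  \<open>f\<close>, and the two new vertices may be any fresh ones.\<close>

lemma iso_add_source:
  assumes f: "dograph_iso f G H" and G: "is_doag G" and H: "is_doag H"
    and x: "x \<notin> verts G" and y: "y \<notin> verts H" and E: "valid_targets G E"
  shows "valid_targets H (map f E)"
    and "dograph_iso (f(x := y)) (add_source x E G) (add_source y (map f E) H)"
proof -
  let ?g = "f(x := y)"
  obtain L where L: "source_list G = L @ filter (\<lambda>v. v \<in> sources G) E"
    using E by (auto simp: valid_targets_def)
  have E': "distinct E" "set E \<subseteq> verts G" using E by (auto simp: valid_targets_def)
  have bij: "bij_betw f (verts G) (verts H)" and inj: "inj_on f (verts G)"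
    and im: "verts H = f ` verts G"
    using f by (auto simp: dograph_iso_def bij_betw_def)
  have "f v \<in> f ` sources G \<longleftrightarrow> v \<in> sources G" if "v \<in> set E" for v
    by (rule inj_on_image_mem_iff[OF inj]) (use that E'(2) is_doagD(7)[OF G] in auto)
  then have L': "source_list H = map f L @ filter (\<lambda>v. v \<in> sources H) (map f E)"
    using iso_source_list[OF f G] by (simp add: L iso_sources[OF f G] filter_map o_def cong: filter_cong)
  have fE: "distinct (map f E)" "set (map f E) \<subseteq> verts H"
    using E' inj im by (auto simp: distinct_map inj_on_subset)
  show "valid_targets H (map f E)" using fE L' by (auto simp: valid_targets_def)
  note GE = add_source_is_doag[OF G x E' L] and HE = add_source_is_doag[OF H y fE L']
  \<comment> \<open>The update at \<open>x\<close> is invisible to the old relations, as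
    \<open>x\<close> is not a vertex of \<open>G\<close>.\<close>
  have eq2: "map_prod ?g ?g ` A = map_prod f f ` A" if "A \<subseteq> verts G \<times> verts G" for A
    using that x by (intro image_cong) auto
  show "dograph_iso ?g (add_source x E G) (add_source y (map f E) H)"
    unfolding dograph_iso_def
  proof (intro conjI ballI)
    have "bij_betw ?g (verts G) (verts H)"
      using bij x by (subst bij_betw_cong[of _ _ f]) auto
    then have "bij_betw ?g (verts G \<union> {x}) (verts H \<union> {?g x})"
      using x y by (intro notIn_Un_bij_betw) auto
    then show "bij_betw ?g (verts (add_source x E G)) (verts (add_source y (map f E) H))"
      by simp
  next
    have "?g ` set E = f ` set E" using x E'(2) by (intro image_cong) auto
    then have "map_prod ?g ?g ` ({x} \<times> set E) = {y} \<times> f ` set E"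
      using image_paired_Times[of ?g ?g "{x}" "set E"] by (simp add: map_prod_def)
    then show "edges (add_source y (map f E) H) = map_prod ?g ?g ` edges (add_source x E G)"
      using eq2[OF is_doagD(2)[OF G]] f by (simp add: image_Un dograph_iso_def)
  next
    have "set L \<subseteq> verts G" using L source_list(2)[OF G] is_doagD(7)[OF G] by auto
    then have "map ?g L = map f L" using x by auto
    then show "src_ord (add_source y (map f E) H) = map_prod ?g ?g ` src_ord (add_source x E G)"
      using source_list(3)[OF GE(1)] source_list(3)[OF HE(1)] GE(2) HE(2)
      by (simp only: list_rel_map[symmetric] list.map fun_upd_same)
  next
    fix v assume v: "v \<in> verts (add_source x E G)"
    show "edge_ord (add_source y (map f E) H) (?g v) =
      map_prod (map_prod ?g ?g) (map_prod ?g ?g) ` edge_ord (add_source x E G) v"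
    proof (cases "v = x")
      case True
      have "map (map_prod ?g ?g) (map (Pair x) E) = map (Pair y) (map f E)"
        using x E'(2) by auto
      then show ?thesis using True by (simp only: fun_upd_same edge_ord_add_source_new list_rel_map[symmetric])
    next
      case False
      then have v: "v \<in> verts G" "?g v = f v" using v by auto
      have "f v \<noteq> y" using v(1) y im by auto
      have "edge_ord G v \<subseteq> edges G \<times> edges G"
        using is_doagD(9)[OF G v(1)] by (auto simp: strict_total_order_def out_edges_def)
      then have "edge_ord G v \<subseteq> (verts G \<times> verts G) \<times> (verts G \<times> verts G)"
        using is_doagD(2)[OF G] by blast
      then have "map_prod (map_prod ?g ?g) (map_prod ?g ?g) ` edge_ord G v =
          map_prod (map_prod f f) (map_prod f f) ` edge_ord G v"
        using x by (intro image_cong) auto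
      then show ?thesis using f v False \<open>f v \<noteq> y\<close> by (simp add: dograph_iso_def)
    qed
  qed
qed

text \<open>The new vertices are the first sources of the two extensions, so \<open>h\<close>
  matches them, and with them their edge lists. What remains is an isomorphism of the smaller graphs
  under the same map.\<close>

lemma iso_add_source_cancel:
  assumes G: "is_doag G" and H: "is_doag H" and x: "x \<notin> verts G" and y: "y \<notin> verts H"
    and E: "valid_targets G E" and F: "valid_targets H F"
    and h: "dograph_iso h (add_source x E G) (add_source y F H)"
  shows "dograph_iso h G H" and "F = map h E"
proof -
  obtain L where L: "source_list G = L @ filter (\<lambda>v. v \<in> sources G) E"
    using E by (auto simp: valid_targets_def)
  obtain M where M: "source_list H = M @ filter (\<lambda>v. v \<in> sources H) F"
    using F by (auto simp: valid_targets_def)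
  have E': "distinct E" "set E \<subseteq> verts G" and F': "distinct F" "set F \<subseteq> verts H"
    using E F by (auto simp: valid_targets_def)
  note GE = add_source_is_doag[OF G x E' L] and HF = add_source_is_doag[OF H y F' M]
  have hx: "h x = y" and hL: "map h L = M"
    using iso_source_list[OF h GE(1)] GE(2) HF(2) by auto
  have "bij_betw h (insert x (verts G)) (insert y (verts H))" using h by (simp add: dograph_iso_def)
  then have inj: "inj_on h (insert x (verts G))" and im: "h ` insert x (verts G) = insert y (verts H)"
    by (auto simp: bij_betw_def)
  have hy: "h v \<noteq> y" if "v \<in> verts G" for v
    using inj that x hx by (metis inj_onD insertCI)
  have bij: "bij_betw h (verts G) (verts H)"
    using inj im hy hx y by (auto simp: bij_betw_def)
  have "edges H \<union> {y} \<times> set F = map_prod h h ` (edges G \<union> {x} \<times> set E)"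
    using h by (simp add: dograph_iso_def)
  \<comment> \<open>Edges not leaving \<open>y\<close> are exactly the old edges of
    \<open>H\<close>; since \<open>h\<close> sends only \<open>x\<close> to \<open>y\<close>, their
    preimages are the old edges of \<open>G\<close>.\<close>
  then have "{e \<in> edges H \<union> {y} \<times> set F. fst e \<noteq> y} =
      {e \<in> map_prod h h ` (edges G \<union> {x} \<times> set E). fst e \<noteq> y}" by simp
  also have "{e \<in> edges H \<union> {y} \<times> set F. fst e \<noteq> y} = edges H"
    using y is_doagD(2)[OF H] by auto
  also have "{e \<in> map_prod h h ` (edges G \<union> {x} \<times> set E). fst e \<noteq> y} = map_prod h h ` edges G"
    using hx hy is_doagD(2)[OF G] by force
  finally have edges: "edges H = map_prod h h ` edges G" .
  show FE: "F = map h E"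
  proof (rule iso_out_list[OF h GE(1), of x])
    show "set E = edges (add_source x E G) `` {x}" using x is_doagD(2)[OF G] by auto
    show "set F = edges (add_source y F H) `` {h x}" using y hx is_doagD(2)[OF H] by auto
  qed (use E' F' hx in simp_all)
  have sources: "sources H = h ` sources G" by (rule sources_image[OF bij edges is_doagD(2)[OF G]])
  have "h v \<in> h ` sources G \<longleftrightarrow> v \<in> sources G" if "v \<in> set E" for v
    by (rule inj_on_image_mem_iff[OF inj]) (use that E'(2) is_doagD(7)[OF G] in auto)
  \<comment> \<open>The extensions only show the sources in \<open>L\<close> and \<open>M\<close>.
    Those covered by the new vertex are recovered, in order, from \<open>E\<close> and
    \<open>F\<close>; this is what validity of the lists provides.\<close>
  then have "source_list H = map h (source_list G)"
    unfolding M L FE sources by (simp add: hL filter_map o_def cong: filter_cong)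
  then have "src_ord H = map_prod h h ` src_ord G"
    using source_list(3)[OF G] source_list(3)[OF H] by (simp only: list_rel_map)
  moreover have "edge_ord H (h v) = map_prod (map_prod h h) (map_prod h h) ` edge_ord G v"
    if "v \<in> verts G" for v
  proof -
    have "v \<noteq> x" "h v \<noteq> y" using that x hy by auto
    moreover have "edge_ord (add_source y F H) (h v) =
        map_prod (map_prod h h) (map_prod h h) ` edge_ord (add_source x E G) v"
      using h that by (simp add: dograph_iso_def)
    ultimately show ?thesis by simp
  qed
  ultimately show "dograph_iso h G H" using bij edges by (simp add: dograph_iso_def)
qed

lemma sources_nonempty:
  assumes "is_doag G" "verts G \<noteq> {}"
  shows "sources G \<noteq> {}"
proof -
  obtain v where "v \<in> verts G" "\<And>u. (u, v) \<in> edges G \<Longrightarrow> u \<notin> verts G"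
    using wfE_min'[OF is_doagD(5)[OF assms(1)] assms(2)] by metis
  then have "v \<in> sources G" using is_doagD(2)[OF assms(1)] by (auto simp: sources_def)
  then show ?thesis by blast
qed

lemma is_doag_eq_add_source:
  assumes G: "is_doag G" and ne: "verts G \<noteq> {}"
  obtains x E H where "is_doag H" "x \<notin> verts H" "valid_targets H E" "G = add_source x E H"
proof -
  note GD = is_doagD[OF G]
  obtain x L where xL: "source_list G = x # L"
    using sources_nonempty[OF assms] source_list(2)[OF G] by (cases "source_list G") auto
  then have x: "x \<in> sources G" "x \<in> verts G" and L: "x \<notin> set L" "distinct L" "set L = sources G - {x}"
    using source_list(1,2)[OF G] GD(7) by auto
  obtain E where E: "distinct E" "set E = edges G `` {x}" "edge_ord G x = list_rel (map (Pair x) E)"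
    using out_list_exists[OF G x(2)] .
  \<comment> \<open>\<open>S\<close> anticipates the sources of \<open>H\<close>. Those among the
    children of \<open>x\<close> form \<open>M\<close> and are placed last, in the order of the
    edges of \<open>x\<close>, as \<open>valid_targets\<close> demands.\<close>
  define S where "S = {v \<in> verts G - {x}. \<nexists>u. u \<noteq> x \<and> (u, v) \<in> edges G}"
  define M where "M = filter (\<lambda>v. v \<in> S) E"
  define H where "H = \<lparr> verts = verts G - {x}, edges = {e \<in> edges G. fst e \<noteq> x},
      edge_ord = edge_ord G, src_ord = list_rel (L @ M) \<rparr>"
  have vH: "verts H = verts G - {x}" and eH: "edges H = {e \<in> edges G. fst e \<noteq> x}"
    and oH: "edge_ord H = edge_ord G" and sH: "src_ord H = list_rel (L @ M)"
    by (simp_all add: H_def)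
  have x_src: "(u, x) \<notin> edges G" for u using x by (auto simp: sources_def)
  have S: "sources H = S" by (auto simp: sources_def S_def vH eH)
  have EV: "set E \<subseteq> verts H" using E(2) GD(2) x_src by (auto simp: vH)
  have LE: "set L \<inter> set E = {}" unfolding L(3) E(2) sources_def by blast
  have LM: "set (L @ M) = S"
  proof -
    have "sources G - {x} \<subseteq> S" unfolding sources_def S_def by blast
    moreover have "v \<in> sources G - {x} \<or> v \<in> edges G `` {x}" if vS: "v \<in> S" for v
    proof (cases "v \<in> sources G")
      case False
      then obtain u where "(u, v) \<in> edges G" using vS by (auto simp: sources_def S_def)
      moreover from this have "u = x" using vS by (auto simp: S_def)
      ultimately show ?thesis by simp
    qed (use vS in \<open>simp add: S_def\<close>)
    moreover have "set (L @ M) = (sources G - {x}) \<union> (edges G `` {x} \<inter> S)"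
      by (auto simp: M_def L(3) E(2))
    ultimately show ?thesis by blast
  qed
  have dLM: "distinct (L @ M)" using L(2) E(1) LE by (auto simp: M_def)
  have sl: "source_list H = L @ filter (\<lambda>v. v \<in> sources H) E"
    using source_listI[OF dLM, of H] LM S sH by (simp add: M_def)
  have "is_doag H"
    unfolding is_doag_def
  proof (intro conjI ballI)
    show "finite (verts H)" using GD(1) by (simp add: vH)
    show "edges H \<subseteq> verts H \<times> verts H" using GD(2) x_src by (auto simp: vH eH)
    show "acyclic (edges H)" using GD(3) by (rule acyclic_subset) (auto simp: eH)
    show "strict_total_order (sources H) (src_ord H)"
      using strict_total_order_list_rel[OF dLM] unfolding LM S sH .
    fix v assume "v \<in> verts H"
    then have "v \<in> verts G" "v \<noteq> x" by (auto simp: vH)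
    then have "out_edges H v = out_edges G v" by (auto simp: out_edges_def eH)
    then show "strict_total_order (out_edges H v) (edge_ord H v)"
      using GD(9)[OF \<open>v \<in> verts G\<close>] by (simp add: oH)
  qed
  moreover have "x \<notin> verts H" by (simp add: vH)
  moreover have "valid_targets H E" using E(1) EV sl by (auto simp: valid_targets_def)
  \<comment> \<open>An equality of records, not just an isomorphism: \<open>H\<close> keeps
    \<open>edge_ord G\<close> everywhere, and \<open>add_source\<close> overwrites it at
    \<open>x\<close> only, with the value that it already has.\<close>
  moreover have "G = add_source x E H"
  proof (rule dograph.equality)
    show "verts G = verts (add_source x E H)" using x(2) by (auto simp: vH)
    show "edges G = edges (add_source x E H)"
      by (auto simp only: add_source_simps eH E(2) Un_iff mem_Collect_eq mem_Sigma_iff fst_conv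
          Image_singleton_iff singleton_iff)
    show "edge_ord G = edge_ord (add_source x E H)"
    proof
      fix v show "edge_ord G v = edge_ord (add_source x E H) v"
        by (cases "v = x") (simp_all add: E(3) oH)
    qed
    have "src_ord (add_source x E H) = list_rel (source_list (add_source x E H))"
      using add_source_is_doag(1)[OF \<open>is_doag H\<close> \<open>x \<notin> verts H\<close> E(1) EV sl] by (rule source_list(3))
    also have "\<dots> = list_rel (x # L)"
      using add_source_is_doag(2)[OF \<open>is_doag H\<close> \<open>x \<notin> verts H\<close> E(1) EV sl] by simp
    also have "\<dots> = src_ord G" using source_list(3)[OF G] xL by simp
    finally show "src_ord G = src_ord (add_source x E H)" by simp
  qed simp
  ultimately show ?thesis using that by blast
qed


section \<open>Classes of graphs and their unique extension\<close>

text \<open>\<open>f\<close> followed by the inverse of \<open>g\<close> is an automorphism of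
  \<open>G\<close>, hence the identity on its vertices.\<close>

lemma iso_unique:
  assumes "dograph_iso f G H" "dograph_iso g G H" "is_doag G" "v \<in> verts G"
  shows "f v = g v"
proof -
  let ?h = "the_inv_into (verts G) g"
  have inj: "inj_on g (verts G)" and im: "g ` verts G = verts H"
    using assms(2) by (auto simp: dograph_iso_def bij_betw_def)
  have "f v \<in> verts H" using assms(1,4) by (auto simp: dograph_iso_def bij_betw_def)
  then have "g (?h (f v)) = f v" using f_the_inv_into_f[OF inj] im by simp
  moreover have "dograph_iso (?h \<circ> f) G G"
    by (rule iso_comp[OF assms(1) iso_the_inv_into[OF assms(2,3)]])
  then have "?h (f v) = v" using iso_self_trivial[OF _ assms(3,4)] by fastforce
  ultimately show ?thesis by simp
qed

lemma iso_card:
  assumes "dograph_iso f G H" "is_doag G"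
  shows "card (verts H) = card (verts G)" "card (edges H) = card (edges G)"
    "card (sources H) = card (sources G)"
proof -
  have inj: "inj_on f (verts G)" and im: "verts H = f ` verts G"
    using assms(1) by (auto simp: dograph_iso_def bij_betw_def)
  show "card (verts H) = card (verts G)" using inj im by (simp add: card_image)
  have "inj_on (map_prod f f) (verts G \<times> verts G)" by (rule map_prod_inj_on[OF inj inj])
  then have "inj_on (map_prod f f) (edges G)" by (rule inj_on_subset[OF _ is_doagD(2)[OF assms(2)]])
  moreover have "edges H = map_prod f f ` edges G" using assms(1) by (simp add: dograph_iso_def)
  ultimately show "card (edges H) = card (edges G)" by (simp add: card_image)
  have "inj_on f (sources G)" by (rule inj_on_subset[OF inj is_doagD(7)[OF assms(2)]])
  then show "card (sources H) = card (sources G)" by (simp add: iso_sources[OF assms] card_image)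
qed

section \<open>Classes with given numbers of vertices, edges and sources\<close>

definition doag_set :: "nat \<Rightarrow> nat \<Rightarrow> nat \<Rightarrow> nat dograph set" where
  "doag_set n m k =
     {G. is_doag G \<and> card (verts G) = n \<and> card (edges G) = m \<and> card (sources G) = k}"

lemma doag_setD:
  assumes "G \<in> doag_set n m k"
  shows "is_doag G" "card (verts G) = n" "card (edges G) = m" "card (sources G) = k"
  using assms by (auto simp: doag_set_def)

lemma doags_eq: "doags n m k = doag_class ` doag_set n m k"
  by (auto simp: doags_def doag_set_def quotient_def doag_class_def)

lemma mem_doag_class: "is_doag G \<Longrightarrow> H \<in> doag_class G \<longleftrightarrow> is_doag H \<and> doag_iso G H"
  by (simp add: doag_class_def doag_eq_def)

lemma doag_iso_sym: "is_doag G \<Longrightarrow> doag_iso G H \<Longrightarrow> doag_iso H G"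
  using iso_the_inv_into by (auto simp: doag_iso_iff)

lemma doag_iso_trans: "doag_iso G H \<Longrightarrow> doag_iso H K \<Longrightarrow> doag_iso G K"
  using iso_comp unfolding doag_iso_iff by metis

lemma doag_iso_refl: "doag_iso G G"
  using iso_refl unfolding doag_iso_iff by metis

lemma doag_class_eq_iff:
  assumes "is_doag G" "is_doag H"
  shows "doag_class G = doag_class H \<longleftrightarrow> doag_iso G H"
proof
  assume "doag_class G = doag_class H"
  moreover have "H \<in> doag_class H" using mem_doag_class[OF assms(2)] doag_iso_refl assms(2) by simp
  ultimately show "doag_iso G H" using mem_doag_class[OF assms(1)] by simp
next
  assume dograph_iso: "doag_iso G H"
  note osi = doag_iso_sym[OF assms(1) dograph_iso]
  show "doag_class G = doag_class H"
  proof (intro set_eqI)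
    fix K
    show "K \<in> doag_class G \<longleftrightarrow> K \<in> doag_class H"
      unfolding mem_doag_class[OF assms(1)] mem_doag_class[OF assms(2)]
      using doag_iso_trans[OF dograph_iso, of K] doag_iso_trans[OF osi, of K] by blast
  qed
qed

lemma doag_set_iso:
  assumes "G \<in> doag_set n m k" "doag_iso G H" "is_doag H"
  shows "H \<in> doag_set n m k"
  using assms iso_card[of _ G H] by (auto simp: doag_set_def doag_iso_iff)

text \<open>The three numbers are invariants of the class, so they can be read off any
  representative.\<close>

lemma doag_class_in_doags_iff:
  assumes "is_doag G"
  shows "doag_class G \<in> doags n m k \<longleftrightarrow> G \<in> doag_set n m k"
proof
  assume "doag_class G \<in> doags n m k"
  then obtain H where H: "H \<in> doag_set n m k" "doag_class G = doag_class H"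
    by (auto simp: doags_eq)
  then have "doag_iso H G" using doag_class_eq_iff[OF doag_setD(1)[OF H(1)] assms] by simp
  then show "G \<in> doag_set n m k" using doag_set_iso[OF H(1)] assms by simp
qed (simp add: doags_eq)

section \<open>Target lists and the unique extension to a given class\<close>

lemma card_add_source:
  assumes G: "is_doag G" and x: "x \<notin> verts G" and E: "valid_targets G E"
  defines "s \<equiv> length (filter (\<lambda>v. v \<in> sources G) E)"
  shows "is_doag (add_source x E G)"
    "card (verts (add_source x E G)) = Suc (card (verts G))"
    "card (edges (add_source x E G)) = card (edges G) + length E"
    "s \<le> card (sources G)"
    "card (sources (add_source x E G)) = Suc (card (sources G) - s)"
proof -
  obtain L where L: "source_list G = L @ filter (\<lambda>v. v \<in> sources G) E"
    using E by (auto simp: valid_targets_def)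
  have E': "distinct E" "set E \<subseteq> verts G" using E by (auto simp: valid_targets_def)
  note GE = add_source_is_doag[OF G x E' L]
  show "is_doag (add_source x E G)" by (rule GE(1))
  show "card (verts (add_source x E G)) = Suc (card (verts G))"
    using x is_doagD(1)[OF G] by simp
  have "edges G \<inter> {x} \<times> set E = {}" using x is_doagD(2)[OF G] by auto
  then show "card (edges (add_source x E G)) = card (edges G) + length E"
    using is_doagD(4)[OF G] E'(1)
    by (simp add: card_Un_disjoint card_cartesian_product distinct_card)
  have "card (sources G) = length L + s"
    using length_source_list[OF G] L by (simp add: s_def)
  moreover have "card (sources (add_source x E G)) = Suc (length L)"
    using length_source_list[OF GE(1)] GE(2) by simp
  ultimately show "s \<le> card (sources G)"
    and "card (sources (add_source x E G)) = Suc (card (sources G) - s)" by simp_all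
qed

text \<open>Describes, without random choices, the lists that \<open>UnifDOAG\<close> can draw for
  \<open>G\<close> and the pair \<open>(p, i)\<close>; \<open>target_lists_UN\<close> makes the
  link.\<close>

definition target_lists :: "nat \<Rightarrow> nat \<Rightarrow> 'v dograph \<Rightarrow> 'v list set" where
  "target_lists p i G =
     {E. valid_targets G E \<and> length E = p \<and> length (filter (\<lambda>v. v \<notin> sources G) E) = i}"

lemma target_listsD:
  assumes "E \<in> target_lists p i G"
  shows "valid_targets G E" "length E = p" "length (filter (\<lambda>v. v \<notin> sources G) E) = i"
    "length (filter (\<lambda>v. v \<in> sources G) E) = p - i" "i \<le> p"
  using assms sum_length_filter_compl[of "\<lambda>v. v \<in> sources G" E] by (auto simp: target_lists_def)

lemma finite_target_lists:
  assumes "is_doag G"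
  shows "finite (target_lists p i G)"
  by (rule finite_subset[OF _ finite_subset_distinct[OF is_doagD(1)[OF assms]]])
    (auto simp: target_lists_def valid_targets_def)

lemma length_filter_iso:
  assumes "dograph_iso f G H" "is_doag G" "set E \<subseteq> verts G"
  shows "length (filter (\<lambda>v. v \<notin> sources H) (map f E)) = length (filter (\<lambda>v. v \<notin> sources G) E)"
proof -
  have inj: "inj_on f (verts G)" using assms(1) by (auto simp: dograph_iso_def bij_betw_def)
  have "f v \<in> f ` sources G \<longleftrightarrow> v \<in> sources G" if "v \<in> set E" for v
    by (rule inj_on_image_mem_iff[OF inj]) (use that assms(3) is_doagD(7)[OF assms(2)] in auto)
  then show ?thesis by (simp add: iso_sources[OF assms(1,2)] filter_map o_def cong: filter_cong)
qed

text \<open>Of the \<open>k - 1 + p - i\<close> sources, \<open>p - i\<close> get covered and one is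
  added. The bounds \<open>p \<le> m\<close> and \<open>1 \<le> k\<close> keep the truncated
  subtractions exact.\<close>

lemma add_source_in_doag_set:
  assumes G: "G \<in> doag_set n (m - p) (k - 1 + p - i)" and x: "x \<notin> verts G"
    and E: "E \<in> target_lists p i G" and "p \<le> m" "1 \<le> k"
  shows "add_source x E G \<in> doag_set (Suc n) m k"
  using card_add_source[OF doag_setD(1)[OF G] x target_listsD(1)[OF E]] target_listsD(2,4,5)[OF E]
    doag_setD(2-4)[OF G] assms(4,5)
  by (simp add: doag_set_def)

text \<open>Removing the smallest source of \<open>K\<close> fixes the pair, the graph
  \<open>H\<close> and a list \<open>F\<close>. Any list leading from \<open>G\<close> to
  \<open>K\<close> is the preimage of \<open>F\<close> under an isomorphism from \<open>G\<close> to
  \<open>H\<close>; by rigidity there is only one such preimage, and carrying \<open>F\<close> along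
  an isomorphism shows that it exists. A cardinality of 0 or 1 serves both the double count and the
  computation of probabilities.\<close>

lemma unique_extension:
  assumes "K \<in> doag_set (Suc n) m k"
  obtains p0 i0 H where "1 \<le> k" "i0 \<le> p0" "p0 \<le> m" "H \<in> doag_set n (m - p0) (k - 1 + p0 - i0)"
    "\<And>p i x (G :: nat dograph). is_doag G \<Longrightarrow> x \<notin> verts G \<Longrightarrow>
       card {E \<in> target_lists p i G. doag_iso (add_source x E G) K} =
         (if p = p0 \<and> i = i0 \<and> doag_iso G H then 1 else (0::nat))"
proof -
  have "is_doag K" "verts K \<noteq> {}" using doag_setD(1,2)[OF assms] by auto
  then obtain y F H where H: "is_doag H" and y: "y \<notin> verts H" and F: "valid_targets H F"
    and K: "K = add_source y F H"
    by (rule is_doag_eq_add_source)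
  define p0 i0 where "p0 = length F" and "i0 = length (filter (\<lambda>v. v \<notin> sources H) F)"
  then have F': "F \<in> target_lists p0 i0 H" using F by (simp add: target_lists_def)
  have FV: "set F \<subseteq> verts H" using F by (simp add: valid_targets_def)
  have c: "1 \<le> k" "i0 \<le> p0" "p0 \<le> m" "H \<in> doag_set n (m - p0) (k - 1 + p0 - i0)"
  proof -
    note cK = card_add_source(2-5)[OF H y F, folded K, unfolded target_listsD(2,4)[OF F']]
    note dK = doag_setD(2-4)[OF assms]
    show "1 \<le> k" "i0 \<le> p0" "p0 \<le> m" using cK dK target_listsD(5)[OF F'] by linarith+
    have "k - 1 + p0 - i0 = card (sources H)" "m - p0 = card (edges H)" "n = card (verts H)"
      using cK dK target_listsD(5)[OF F'] by linarith+
    then show "H \<in> doag_set n (m - p0) (k - 1 + p0 - i0)" using H by (simp add: doag_set_def)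
  qed
  have ext: "card {E \<in> target_lists p i G. doag_iso (add_source x E G) K} =
      (if p = p0 \<and> i = i0 \<and> doag_iso G H then 1 else (0::nat))"
    if G: "is_doag G" and x: "x \<notin> verts G" for p i x and G :: "nat dograph"
  proof -
    define A where "A = {E \<in> target_lists p i G. doag_iso (add_source x E G) K}"
    have A: "p = p0 \<and> i = i0 \<and> (\<exists>h. dograph_iso h G H \<and> F = map h E)" if EA: "E \<in> A" for E
    proof -
      have E: "E \<in> target_lists p i G" using EA by (simp add: A_def)
      note EV = target_listsD(1)[OF E]
      obtain h where h: "dograph_iso h (add_source x E G) (add_source y F H)"
        using EA by (auto simp: A_def doag_iso_iff K)
      note hG = iso_add_source_cancel[OF G H x y EV F h]
      have "set E \<subseteq> verts G" using EV by (simp add: valid_targets_def)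
      note len = length_filter_iso[OF hG(1) G this]
      have "p = p0" using target_listsD(2)[OF E] by (simp add: p0_def hG(2))
      moreover have "i = i0"
        using target_listsD(3)[OF E] len by (simp only: i0_def hG(2))
      ultimately show ?thesis using hG by auto
    qed
    have eq: "E = E'" if EA: "E \<in> A" "E' \<in> A" for E E'
    proof -
      obtain h h' where h: "dograph_iso h G H" "F = map h E" and h': "dograph_iso h' G H" "F = map h' E'"
        using A[OF EA(1)] A[OF EA(2)] by blast
      have V: "set E \<subseteq> verts G" "set E' \<subseteq> verts G"
        using EA by (auto simp: A_def target_lists_def valid_targets_def)
      have "h v = h' v" if "v \<in> set E" for v
        by (rule iso_unique[OF h(1) h'(1) G subsetD[OF V(1) that]])
      then have "map h E = map h' E" by simp
      then have "map h' E = map h' E'" using h(2) h'(2) by simp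
      moreover have "inj_on h' (verts G)" using h'(1) by (auto simp: dograph_iso_def bij_betw_def)
      then have "inj_on h' (set E \<union> set E')" by (rule inj_on_subset) (use V in simp)
      ultimately show ?thesis by (rule map_inj_on)
    qed
    show ?thesis
    proof (cases "p = p0 \<and> i = i0 \<and> doag_iso G H")
      case True
      then obtain f where "dograph_iso f H G" using doag_iso_sym[OF G] by (auto simp: doag_iso_iff)
      note f = this iso_add_source[OF this H G y x F]
      note f4 = length_filter_iso[OF f(1) H FV]
      have "doag_iso K (add_source x (map f F) G)" using f(3) K by (auto simp: doag_iso_iff)
      then have "doag_iso (add_source x (map f F) G) K" by (rule doag_iso_sym[OF \<open>is_doag K\<close>])
      then have "map f F \<in> A"
        using f(2) f4 True by (simp add: A_def target_lists_def p0_def i0_def)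
      then have "A = {map f F}" using eq by blast
      then show ?thesis using True by (simp add: A_def)
    next
      case False
      then have "A = {}" using A by (auto simp: doag_iso_iff)
      then show ?thesis using False unfolding A_def[symmetric] by simp
    qed
  qed
  show ?thesis by (rule that[OF c]) (rule ext)
qed


lemma doags_unique_extension:
  assumes C: "C \<in> doags (Suc n) m k"
  obtains p0 i0 c0 where "1 \<le> k" "i0 \<le> p0" "p0 \<le> m" "c0 \<in> doags n (m - p0) (k - 1 + p0 - i0)"
    "\<And>p i x (G :: nat dograph). is_doag G \<Longrightarrow> x \<notin> verts G \<Longrightarrow>
       card {E \<in> target_lists p i G. doag_class (add_source x E G) = C} =
         (if p = p0 \<and> i = i0 \<and> doag_class G = c0 then 1 else (0::nat))"
proof -
  obtain K where K: "K \<in> doag_set (Suc n) m k" "C = doag_class K"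
    using C by (auto simp: doags_eq)
  obtain p0 i0 H where *: "1 \<le> k" "i0 \<le> p0" "p0 \<le> m" and
    H: "H \<in> doag_set n (m - p0) (k - 1 + p0 - i0)" and
    ext: "\<And>p i x (G :: nat dograph). is_doag G \<Longrightarrow> x \<notin> verts G \<Longrightarrow>
       card {E \<in> target_lists p i G. doag_iso (add_source x E G) K} =
         (if p = p0 \<and> i = i0 \<and> doag_iso G H then 1 else (0::nat))"
    by (rule unique_extension[OF K(1)]) (rule that)
  have "doag_class H \<in> doags n (m - p0) (k - 1 + p0 - i0)"
    using H by (simp add: doags_eq)
  moreover have "card {E \<in> target_lists p i G. doag_class (add_source x E G) = C} =
         (if p = p0 \<and> i = i0 \<and> doag_class G = doag_class H then 1 else (0::nat))"
    if G: "is_doag G" and x: "x \<notin> verts G" for p i x G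
  proof -
    have "doag_class (add_source x E G) = C \<longleftrightarrow> doag_iso (add_source x E G) K"
      if "E \<in> target_lists p i G" for E
      unfolding K(2)
      by (rule doag_class_eq_iff[OF card_add_source(1)[OF G x target_listsD(1)[OF that]] doag_setD(1)[OF K(1)]])
    then have "{E \<in> target_lists p i G. doag_class (add_source x E G) = C} =
        {E \<in> target_lists p i G. doag_iso (add_source x E G) K}" by blast
    then show ?thesis
      using ext[OF G x, of p i] doag_class_eq_iff[OF G doag_setD(1)[OF H]] by simp
  qed
  ultimately show ?thesis by (rule that[OF *])
qed

section \<open>A uniform target list as a sequence of random choices\<close>

text \<open>An interleaving restricted to \<open>I\<close> gives back \<open>xs\<close>, so
  different permutations have disjoint sets of interleavings, and all these sets have the same size.
  In such a union, choosing a block uniformly and then a member of it is a uniform choice.\<close>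

lemma pmf_of_set_permutations_shuffles:
  fixes I :: "'a set" and ls :: "'a list"
  assumes I: "finite I" and disj: "I \<inter> set ls = {}"
  defines "A \<equiv> \<Union>xs\<in>permutations_of_set I. shuffles xs ls"
  shows "card A = fact (card I) * ((card I + length ls) choose card I)"
    and "pmf_of_set A = do {xs \<leftarrow> pmf_of_set (permutations_of_set I); pmf_of_set (shuffles xs ls)}"
    and "finite A" and "A \<noteq> {}"
proof -
  have card: "card (shuffles xs ls) = (card I + length ls) choose card I"
    if "xs \<in> permutations_of_set I" for xs
  proof -
    have "set xs = I" "length xs = card I"
      using that by (auto simp: permutations_of_set_def distinct_card)
    then show ?thesis using card_disjoint_shuffles[of xs ls] disj by simp
  qed
  have dis: "disjoint_family_on (\<lambda>xs. shuffles xs ls) (permutations_of_set I)"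
    unfolding disjoint_family_on_def
  proof (intro ballI impI)
    fix xs ys assume xy: "xs \<in> permutations_of_set I" "ys \<in> permutations_of_set I" "xs \<noteq> ys"
    then have sets: "set xs = I" "set ys = I" by (auto simp: permutations_of_set_def)
    have "xs = ys" if "E \<in> shuffles xs ls" "E \<in> shuffles ys ls" for E
      using filter_shuffles_disjoint1(1)[OF _ that(1)] filter_shuffles_disjoint1(1)[OF _ that(2)]
        disj sets by simp
    then show "shuffles xs ls \<inter> shuffles ys ls = {}" using xy(3) by blast
  qed
  show fin: "finite A" using I by (simp add: A_def)
  have ne: "permutations_of_set I \<noteq> {}" using I by simp
  have sne: "shuffles xs ls \<noteq> {}" for xs
    by (induction xs ls rule: shuffles.induct) simp_all
  show "A \<noteq> {}" using ne sne by (auto simp: A_def)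
  show "pmf_of_set A = do {xs \<leftarrow> pmf_of_set (permutations_of_set I); pmf_of_set (shuffles xs ls)}"
    unfolding A_def
    by (rule pmf_of_set_UN[OF fin[unfolded A_def] ne sne card dis])
  have "card A = (\<Sum>xs\<in>permutations_of_set I. card (shuffles xs ls))"
    unfolding A_def using dis I
    by (intro card_UN_disjoint') (auto simp: finite_shuffles)
  also have "\<dots> = fact (card I) * ((card I + length ls) choose card I)"
    using I by (simp add: card)
  finally show "card A = fact (card I) * ((card I + length ls) choose card I)" .
qed

lemma largest_sources:
  assumes G: "is_doag G" and s: "s \<le> card (sources G)"
  shows "length (largest_sources s G) = s" "set (largest_sources s G) \<subseteq> sources G"
    "distinct (largest_sources s G)" "\<exists>L. source_list G = L @ largest_sources s G"
proof -
  show "length (largest_sources s G) = s"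
    using s by (simp add: largest_sources_def length_source_list[OF G])
  show "set (largest_sources s G) \<subseteq> sources G"
    unfolding largest_sources_def source_list(2)[OF G, symmetric] by (rule set_drop_subset)
  show "distinct (largest_sources s G)"
    unfolding largest_sources_def by (rule distinct_drop[OF source_list(1)[OF G]])
  show "\<exists>L. source_list G = L @ largest_sources s G"
    unfolding largest_sources_def by (metis append_take_drop_id)
qed

lemma target_lists_UN:
  assumes G: "is_doag G" and i: "i \<le> p" and s: "p - i \<le> card (sources G)"
  shows "target_lists p i G = (\<Union>I\<in>{I. I \<subseteq> verts G - sources G \<and> card I = i}.
           \<Union>xs\<in>permutations_of_set I. shuffles xs (largest_sources (p - i) G))"
    (is "_ = ?R")
proof (intro set_eqI iffI)
  let ?ls = "largest_sources (p - i) G"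
  note ls = largest_sources[OF G s]
  fix E assume E: "E \<in> target_lists p i G"
  then have V: "distinct E" "set E \<subseteq> verts G"
    and "\<exists>L. source_list G = L @ filter (\<lambda>v. v \<in> sources G) E"
    by (auto simp: target_lists_def valid_targets_def)
  then obtain L where L: "source_list G = L @ filter (\<lambda>v. v \<in> sources G) E" by blast
  \<comment> \<open>Both \<open>?ls\<close> and the sources in \<open>E\<close> are suffixes of the
    source list, of the same length \<open>p - i\<close>; hence they coincide.\<close>
  obtain M where "source_list G = M @ ?ls" using ls(4) by blast
  then have ls_eq: "filter (\<lambda>v. v \<in> sources G) E = ?ls"
    using L ls(1) target_listsD(4)[OF E] by simp
  define xs where "xs = filter (\<lambda>v. v \<notin> sources G) E"
  have "E \<in> shuffles xs ?ls"
    using partition_in_shuffles[of E "\<lambda>v. v \<notin> sources G"] by (simp add: xs_def ls_eq)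
  moreover have "xs \<in> permutations_of_set (set xs)"
    using V by (simp add: permutations_of_set_def xs_def)
  moreover have "card (set xs) = i"
    using V target_listsD(3)[OF E] distinct_card[of xs] by (simp add: xs_def)
  moreover have "set xs \<subseteq> verts G - sources G" using V by (auto simp: xs_def)
  ultimately show "E \<in> ?R" by blast
next
  let ?ls = "largest_sources (p - i) G"
  note ls = largest_sources[OF G s]
  fix E assume "E \<in> ?R"
  then obtain I xs where I: "I \<subseteq> verts G - sources G" "card I = i"
    and xs: "set xs = I" "distinct xs" and E: "E \<in> shuffles xs ?ls"
    by (auto simp: permutations_of_set_def)
  have disj: "set xs \<inter> set ?ls = {}" using I(1) xs(1) ls(2) by blast
  have setE: "set E = set xs \<union> set ?ls" by (rule set_shuffles[OF E])
  have src: "v \<in> sources G \<longleftrightarrow> v \<in> set ?ls" "v \<notin> sources G \<longleftrightarrow> v \<notin> set ?ls" if "v \<in> set E" for v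
    using that setE I(1) xs(1) ls(2) by blast+
  have f1: "filter (\<lambda>v. v \<in> sources G) E = ?ls"
    using filter_shuffles_disjoint2(1)[OF disj E] src(1) by (metis (mono_tags, lifting) filter_cong)
  have f2: "filter (\<lambda>v. v \<notin> sources G) E = xs"
    using filter_shuffles_disjoint2(2)[OF disj E] src(2) by (metis (mono_tags, lifting) filter_cong)
  have "distinct E" by (rule distinct_disjoint_shuffles[OF xs(2) ls(3) disj E])
  moreover have "set E \<subseteq> verts G" using setE I(1) xs(1) ls(2) is_doagD(7)[OF G] by blast
  moreover have "length xs = i" using xs I(2) distinct_card by fastforce
  moreover have "length E = p" using length_shuffles[OF E] ls(1) \<open>length xs = i\<close> i by simp
  ultimately show "E \<in> target_lists p i G"
    using ls(4) f1 f2 by (simp add: target_lists_def valid_targets_def)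
qed

text \<open>The union over the sets \<open>I\<close> is again disjoint with blocks of equal size, as
  \<open>I\<close> consists of the entries outside the largest sources. The bound on
  \<open>i\<close> makes a choice of \<open>I\<close> possible; \<open>pmf_of_set\<close> says
  nothing for an empty set.\<close>

lemma pmf_of_set_target_lists:
  assumes G: "is_doag G" and i: "i \<le> p" and s: "p - i \<le> card (sources G)"
  shows "card (target_lists p i G) = (card (verts G - sources G) choose i) * (fact i * (p choose i))"
    and "i \<le> card (verts G - sources G) \<Longrightarrow> pmf_of_set (target_lists p i G) =
      do {
        I \<leftarrow> pmf_of_set {I. I \<subseteq> verts G - sources G \<and> card I = i};
        xs \<leftarrow> pmf_of_set (permutations_of_set I);
        pmf_of_set (shuffles xs (largest_sources (p - i) G))
      }"
proof -
  let ?ls = "largest_sources (p - i) G"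
  let ?S = "{I. I \<subseteq> verts G - sources G \<and> card I = i}"
  let ?A = "\<lambda>I. \<Union>xs\<in>permutations_of_set I. shuffles xs ?ls"
  note ls = largest_sources[OF G s]
  note UN = target_lists_UN[OF assms]
  have finV: "finite (verts G - sources G)" using is_doagD(1)[OF G] by simp
  then have finS: "finite ?S" by simp
  have I: "finite I" "I \<inter> set ?ls = {}" "card I = i" if "I \<in> ?S" for I
    using that ls(2) finite_subset[OF _ finV] by auto
  note A = pmf_of_set_permutations_shuffles[OF I(1,2)]
  have cardA: "card (?A I) = fact i * (p choose i)" if "I \<in> ?S" for I
    using A(1)[OF that that] I(3)[OF that] ls(1) i by simp
  have dis: "disjoint_family_on ?A ?S"
    unfolding disjoint_family_on_def
  proof (intro ballI impI)
    fix I J assume IJ: "I \<in> ?S" "J \<in> ?S" "I \<noteq> J"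
    have "K = set E - set ?ls" if KS: "K \<in> ?S" and EA: "E \<in> ?A K" for E K
    proof -
      obtain xs where xs: "set xs = K" "E \<in> shuffles xs ?ls"
        using EA by (auto simp: permutations_of_set_def)
      then show ?thesis using set_shuffles[OF xs(2)] I(2)[OF KS] by blast
    qed
    then show "?A I \<inter> ?A J = {}" using IJ by blast
  qed
  have "card (target_lists p i G) = (\<Sum>I\<in>?S. card (?A I))"
    unfolding UN using dis finS A(3)
    by (intro card_UN_disjoint') auto
  also have "\<dots> = card ?S * (fact i * (p choose i))" by (simp add: cardA)
  finally show "card (target_lists p i G) =
      (card (verts G - sources G) choose i) * (fact i * (p choose i))"
    by (simp add: n_subsets[OF finV])
  assume "i \<le> card (verts G - sources G)"
  then have "card ?S > 0" by (simp add: n_subsets[OF finV])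
  then have ne: "?S \<noteq> {}" by (metis card.empty less_irrefl)
  have "pmf_of_set (target_lists p i G) = do {I \<leftarrow> pmf_of_set ?S; pmf_of_set (?A I)}"
    unfolding UN
    by (rule pmf_of_set_UN[OF finite_target_lists[OF G, of p i, unfolded UN] ne A(4) cardA dis])
  also have "\<dots> = do {I \<leftarrow> pmf_of_set ?S; xs \<leftarrow> pmf_of_set (permutations_of_set I);
      pmf_of_set (shuffles xs ?ls)}"
    using A(2) finS ne by (intro bind_pmf_cong refl) simp
  finally show "pmf_of_set (target_lists p i G) = \<dots>" .
qed


section \<open>Recurrence for the number of DOAGs and the search for the pair\<close>

text \<open>The assumption can only hold for \<open>m = 0\<close> and \<open>k = 1\<close>, so the
  base case of the sampler may ignore both numbers.\<close>

lemma doag_class_single_vertex: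
  assumes "G \<in> doag_set (Suc 0) m k"
  shows "single_vertex \<in> doag_set (Suc 0) m k" "doag_class G = doag_class single_vertex"
proof -
  note G = doag_setD[OF assms]
  note GD = is_doagD[OF G(1)]
  obtain v where v: "verts G = {v}" using G(2) by (auto simp: card_Suc_eq)
  have "(v, v) \<notin> edges G" using GD(3) by (auto simp: acyclic_def)
  then have e: "edges G = {}" using GD(2) v by auto
  then have s: "sources G = {v}" using v by (simp add: sources_def)
  have o: "edge_ord G v = {}"
    using GD(9)[of v] v e by (simp add: strict_total_order_def out_edges_def)
  have so: "src_ord G = {}"
    using GD(8) s by (auto simp: strict_total_order_def strict_linear_order_on_def irrefl_def)
  have S: "is_doag single_vertex"
    by (auto simp: is_doag_def single_vertex_def strict_total_order_def strict_linear_order_on_def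
        acyclic_def out_edges_def sources_def irrefl_def total_on_def trans_def)
  have "dograph_iso (\<lambda>_. 0) G single_vertex"
    using v e o so by (auto simp: dograph_iso_def single_vertex_def bij_betw_def)
  then have dograph_iso: "doag_iso G single_vertex" by (auto simp: doag_iso_iff)
  show "single_vertex \<in> doag_set (Suc 0) m k" by (rule doag_set_iso[OF assms dograph_iso S])
  show "doag_class G = doag_class single_vertex" using doag_class_eq_iff[OF G(1) S] dograph_iso by simp
qed

text \<open>For counting classes any representative and any fresh vertex will do, because
  \<open>doags_unique_extension\<close> holds for all of them.\<close>

definition class_rep :: "nat dograph set \<Rightarrow> nat dograph" where
  "class_rep c = (SOME G. is_doag G \<and> doag_class G = c)"

definition fresh_vertex :: "nat dograph \<Rightarrow> nat" where
  "fresh_vertex G = (SOME x. x \<notin> verts G)"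

lemma class_rep:
  assumes "c \<in> doags n m k"
  shows "class_rep c \<in> doag_set n m k" "doag_class (class_rep c) = c" "is_doag (class_rep c)"
proof -
  obtain G where "is_doag G" "doag_class G = c"
    using assms unfolding doags_eq doag_set_def by blast
  then have "is_doag (class_rep c) \<and> doag_class (class_rep c) = c"
    unfolding class_rep_def by (intro someI[of "\<lambda>G. is_doag G \<and> doag_class G = c" G]) simp
  then show "is_doag (class_rep c)" "doag_class (class_rep c) = c" by simp_all
  then show "class_rep c \<in> doag_set n m k"
    using doag_class_in_doags_iff[of "class_rep c" n m k] assms by simp
qed

lemma fresh_vertex: "is_doag G \<Longrightarrow> fresh_vertex G \<notin> verts G"
  unfolding fresh_vertex_def by (rule someI_ex) (rule ex_new_if_finite[OF infinite_UNIV_nat is_doagD(1)])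

text \<open>There are infinitely many graphs on \<open>nat\<close>, so finiteness of the quotient
  needs an argument: each class extends the chosen representative of a smaller class by one of
  finitely many lists.\<close>

lemma finite_doags: "finite (doags (Suc n) m k)"
proof (induction n arbitrary: m k)
  case 0
  have "doags (Suc 0) m k \<subseteq> {doag_class single_vertex}"
    using doag_class_single_vertex(2) by (auto simp: doags_eq)
  then show ?case using finite_subset by blast
next
  case (Suc n)
  let ?X = "\<lambda>p i c. (\<lambda>E. doag_class (add_source (fresh_vertex (class_rep c)) E (class_rep c))) `
      target_lists p i (class_rep c)"
  have "doags (Suc (Suc n)) m k \<subseteq>
      (\<Union>p\<in>{..m}. \<Union>i\<in>{..p}. \<Union>c\<in>doags (Suc n) (m - p) (k - 1 + p - i). ?X p i c)"
  proof
    fix C assume "C \<in> doags (Suc (Suc n)) m k"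
    then obtain p0 i0 c0 where 1: "i0 \<le> p0" "p0 \<le> m"
      and c0: "c0 \<in> doags (Suc n) (m - p0) (k - 1 + p0 - i0)"
      and ext: "\<And>p i x (G :: nat dograph). is_doag G \<Longrightarrow> x \<notin> verts G \<Longrightarrow>
       card {E \<in> target_lists p i G. doag_class (add_source x E G) = C} =
         (if p = p0 \<and> i = i0 \<and> doag_class G = c0 then 1 else (0::nat))"
      by (rule doags_unique_extension) (rule that)
    note G = class_rep[OF c0]
    have "card {E \<in> target_lists p0 i0 (class_rep c0).
        doag_class (add_source (fresh_vertex (class_rep c0)) E (class_rep c0)) = C} = 1"
      using ext[OF G(3) fresh_vertex[OF G(3)], of p0 i0] G(2) by simp
    then have "{E \<in> target_lists p0 i0 (class_rep c0).
        doag_class (add_source (fresh_vertex (class_rep c0)) E (class_rep c0)) = C} \<noteq> {}"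
      by force
    then have "C \<in> ?X p0 i0 c0" by blast
    then show "C \<in> (\<Union>p\<in>{..m}. \<Union>i\<in>{..p}. \<Union>c\<in>doags (Suc n) (m - p) (k - 1 + p - i). ?X p i c)"
      using 1 c0 by blast
  qed
  moreover have "finite (\<Union>p\<in>{..m}. \<Union>i\<in>{..p}. \<Union>c\<in>doags (Suc n) (m - p) (k - 1 + p - i). ?X p i c)"
    using Suc finite_target_lists[OF class_rep(3)] by (intro finite_UN_I finite_atMost finite_imageI) auto
  ultimately show ?case by (rule finite_subset)
qed

text \<open>\<open>Suc n + i - (k + p)\<close> is the number of non-sources of \<open>G\<close>, so
  the count depends on the parameters only and not on \<open>G\<close>. The subtraction is exact
  because \<open>G\<close> has at most \<open>n\<close> sources.\<close>

lemma card_target_lists: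
  assumes G: "G \<in> doag_set n m' (k - 1 + p - i)" and i: "i \<le> p" and k: "1 \<le> k"
  shows "card (target_lists p i G) = cofactor (Suc n) k p i"
proof -
  note GD = doag_setD[OF G]
  have "card (verts G - sources G) = n - (k - 1 + p - i)"
    using card_Diff_subset[OF is_doagD(6,7)[OF GD(1)]] GD by simp
  also have "\<dots> = Suc n + i - (k + p)"
    using i k card_mono[OF is_doagD(1,7)[OF GD(1)]] GD by simp
  finally show ?thesis
    using pmf_of_set_target_lists(1)[OF GD(1) i] GD(4) i k by (simp add: cofactor_def)
qed

lemma set_lex_pairs: "set (lex_pairs m) = {(p, i). i \<le> p \<and> p \<le> m}"
  by (auto simp: lex_pairs_def image_iff simp del: upt_Suc)

lemma distinct_lex_pairs: "distinct (lex_pairs m)"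
proof -
  have "distinct (concat (map (\<lambda>p. map (\<lambda>i. (p, i)) [0..<Suc p]) [0..<l]))" for l
    by (induction l) (auto simp: distinct_map inj_on_def simp del: upt_Suc simp: upt_Suc_append)
  then show ?thesis unfolding lex_pairs_def by blast
qed

lemma sorted_lex_pairs: "sorted_wrt (\<lambda>x y. fst x \<le> fst y) (lex_pairs m)"
proof -
  have row: "sorted_wrt (\<lambda>x y. fst x \<le> fst y) (map (\<lambda>i. (p :: nat, i)) [0..<l])" for p l
    by (simp add: sorted_wrt_map)
  have "sorted_wrt (\<lambda>x y. fst x \<le> fst y) (concat (map (\<lambda>p. map (\<lambda>i. (p, i)) [0..<Suc p]) [0..<l]))" for l
  proof (induction l)
    case (Suc l)
    then show ?case using row[of l "Suc l"]
      by (auto simp: sorted_wrt_append simp del: upt_Suc simp: upt_Suc_append)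
  qed simp
  then show ?thesis unfolding lex_pairs_def by blast
qed

lemma T_eq: "T n m k p i = D (n - 1) (m - p) (k - 1 + p - i) * cofactor n k p i"
  by (simp add: T_def cofactor_def)

text \<open>Counts the triples of a pair, a smaller class and a target list in two ways: each pair
  and class admit \<open>cofactor\<close> many lists, and each class \<open>C\<close> is produced by
  a single triple. For \<open>k = 0\<close> the identity can fail, as the truncated
  \<open>k - 1\<close> is then 0.\<close>

lemma D_recurrence:
  assumes k: "1 \<le> k"
  shows "D (Suc (Suc l)) m k = (\<Sum>(p, i)\<leftarrow>lex_pairs m. T (Suc (Suc l)) m k p i)"
proof -
  let ?P = "set (lex_pairs m)"
  let ?d = "\<lambda>(p, i). doags (Suc l) (m - p) (k - 1 + p - i)"
  let ?new = "\<lambda>c E. doag_class (add_source (fresh_vertex (class_rep c)) E (class_rep c))"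
  let ?L = "\<lambda>(p, i) c. target_lists p i (class_rep c)"
  let ?C = "doags (Suc (Suc l)) m k"
  have fin: "finite (?d x)" for x using finite_doags by (cases x) auto
  have 1: "T (Suc (Suc l)) m k (fst x) (snd x) = (\<Sum>c\<in>?d x. \<Sum>C\<in>?C. card {E \<in> ?L x c. ?new c E = C})"
    if x: "x \<in> ?P" for x
  proof -
    obtain p i where x: "x = (p, i)" "i \<le> p" "p \<le> m" using x by (auto simp: set_lex_pairs)
    have "(\<Sum>C\<in>?C. card {E \<in> target_lists p i (class_rep c). ?new c E = C}) = cofactor (Suc (Suc l)) k p i"
      if c: "c \<in> doags (Suc l) (m - p) (k - 1 + p - i)" for c
    proof -
      note G = class_rep[OF c]
      have fL: "finite (target_lists p i (class_rep c))" by (rule finite_target_lists[OF G(3)])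
      \<comment> \<open>Every extension lies in \<open>?C\<close>, so grouping the lists by the
        class they produce loses none.\<close>
      have "?new c ` target_lists p i (class_rep c) \<subseteq> ?C"
        using add_source_in_doag_set[OF G(1) fresh_vertex[OF G(3)] _ x(3) k]
        by (auto simp: doags_eq)
      then have "(\<Sum>C\<in>?C. \<Sum>E\<in>{E \<in> target_lists p i (class_rep c). ?new c E = C}. 1 :: nat) =
          (\<Sum>E\<in>target_lists p i (class_rep c). 1)"
        by (rule sum.group[OF fL finite_doags])
      then show ?thesis using card_target_lists[OF G(1) x(2) k] by (simp only: card_eq_sum)
    qed
    then show ?thesis by (simp add: x(1) T_eq D_def)
  qed
  have 2: "(\<Sum>x\<in>?P. \<Sum>c\<in>?d x. card {E \<in> ?L x c. ?new c E = C}) = 1" if C: "C \<in> ?C" for C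
  proof -
    obtain p0 i0 c0 where 1: "i0 \<le> p0" "p0 \<le> m"
      and c0: "c0 \<in> doags (Suc l) (m - p0) (k - 1 + p0 - i0)"
      and ext: "\<And>p i x (G :: nat dograph). is_doag G \<Longrightarrow> x \<notin> verts G \<Longrightarrow>
       card {E \<in> target_lists p i G. doag_class (add_source x E G) = C} =
         (if p = p0 \<and> i = i0 \<and> doag_class G = c0 then 1 else (0::nat))"
      using C by (rule doags_unique_extension) (rule that)
    have "(\<Sum>c\<in>?d x. card {E \<in> ?L x c. ?new c E = C}) = (if x = (p0, i0) then 1 else 0)" for x
    proof -
      obtain p i where x: "x = (p, i)" by fastforce
      have "card {E \<in> ?L x c. ?new c E = C} = (if c = c0 then if x = (p0, i0) then 1 else 0 else 0)"
        if "c \<in> ?d x" for c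
      proof -
        note G = class_rep[OF that[unfolded x prod.case]]
        show ?thesis using ext[OF G(3) fresh_vertex[OF G(3)], of p i] G(2) x by simp
      qed
      then have "(\<Sum>c\<in>?d x. card {E \<in> ?L x c. ?new c E = C}) =
          (\<Sum>c\<in>?d x. if c = c0 then if x = (p0, i0) then 1 else 0 else 0)"
        by (rule sum.cong[OF refl])
      also have "\<dots> = (if c0 \<in> ?d x then if x = (p0, i0) then 1 else 0 else 0)"
        by (rule sum.delta[OF fin])
      also have "\<dots> = (if x = (p0, i0) then 1 else 0)" using c0 by simp
      finally show ?thesis .
    qed
    then have "(\<Sum>x\<in>?P. \<Sum>c\<in>?d x. card {E \<in> ?L x c. ?new c E = C}) =
        (\<Sum>x\<in>?P. if x = (p0, i0) then 1 else 0)"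
      by (intro sum.cong refl)
    moreover have "(p0, i0) \<in> ?P" using 1 by (simp add: set_lex_pairs)
    ultimately show ?thesis by simp
  qed
  have "(\<Sum>(p, i)\<leftarrow>lex_pairs m. T (Suc (Suc l)) m k p i) = (\<Sum>x\<in>?P. T (Suc (Suc l)) m k (fst x) (snd x))"
    using sum_list_distinct_conv_sum_set[OF distinct_lex_pairs,
        where f = "\<lambda>(p, i). T (Suc (Suc l)) m k p i"]
    by (simp add: case_prod_beta)
  also have "\<dots> = (\<Sum>x\<in>?P. \<Sum>c\<in>?d x. \<Sum>C\<in>?C. card {E \<in> ?L x c. ?new c E = C})"
    by (rule sum.cong[OF refl 1])
  also have "\<dots> = (\<Sum>x\<in>?P. \<Sum>C\<in>?C. \<Sum>c\<in>?d x. card {E \<in> ?L x c. ?new c E = C})"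
    by (rule sum.cong[OF refl]) (rule sum.swap)
  also have "\<dots> = (\<Sum>C\<in>?C. \<Sum>x\<in>?P. \<Sum>c\<in>?d x. card {E \<in> ?L x c. ?new c E = C})"
    by (rule sum.swap)
  also have "\<dots> = (\<Sum>C\<in>?C. 1)" by (rule sum.cong[OF refl 2])
  finally show ?thesis by (simp add: D_def)
qed

section \<open>The search for the pair: frequencies and cost\<close>

text \<open>The partial sum passes \<open>r\<close> at the pair where the search stops, so the term
  there is positive. For \<open>T\<close> this means that the recursive call of the sampler has a
  positive \<open>D\<close>.\<close>

lemma scan_spec_result:
  assumes "S \<le> r" "r < S + (\<Sum>(p, i)\<leftarrow>xs. t p i)"
  shows "scan_spec t r xs S \<in> set xs" "(case scan_spec t r xs S of (p, i) \<Rightarrow> 0 < t p i)"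
  using assms
proof (induction xs arbitrary: S)
  case (Cons x xs)
  obtain p i where x: "x = (p, i)" by fastforce
  {
    case 1
    show ?case using Cons.IH(1)[of "S + t p i"] 1 x by (auto simp: add.assoc)
  next
    case 2
    show ?case using Cons.IH(2)[of "S + t p i"] 2 x by (auto simp: add.assoc)
  }
qed simp_all

text \<open>The terms cut the interval into consecutive blocks of lengths \<open>t p i\<close>, and
  \<open>r\<close> selects the pair in whose block it lies. Distinctness gives each pair a single
  block.\<close>

lemma card_scan_spec:
  assumes "distinct xs" "(p, i) \<in> set xs"
  shows "card {r \<in> {S..<S + (\<Sum>(p, i)\<leftarrow>xs. t p i)}. scan_spec t r xs S = (p, i)} = t p i"
  using assms
proof (induction xs arbitrary: S)
  case (Cons x xs)
  obtain p' i' where x: "x = (p', i')" by fastforce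
  let ?S = "S + t p' i'"
  let ?N = "\<Sum>(p, i)\<leftarrow>xs. t p i"
  have N: "S + (\<Sum>(p, i)\<leftarrow>x # xs. t p i) = ?S + ?N" by (simp add: x add.assoc)
  have split: "{r \<in> {S..<?S + ?N}. scan_spec t r (x # xs) S = (p, i)} =
      {r \<in> {S..<?S}. (p', i') = (p, i)} \<union> {r \<in> {?S..<?S + ?N}. scan_spec t r xs ?S = (p, i)}"
    by (auto simp: x)
  show ?case
  proof (cases "(p', i') = (p, i)")
    case True
    then have "(p, i) \<notin> set xs" using Cons.prems(1) x by simp
    then have "scan_spec t r xs ?S \<noteq> (p, i)" if "r \<in> {?S..<?S + ?N}" for r
      using scan_spec_result(1)[of ?S r t xs] that by auto
    then have "{r \<in> {?S..<?S + ?N}. scan_spec t r xs ?S = (p, i)} = {}" by blast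
    moreover have "{r \<in> {S..<?S}. (p', i') = (p, i)} = {S..<?S}" using True by auto
    ultimately show ?thesis unfolding N split using True
      by (simp only: Un_empty_right card_atLeastLessThan diff_add_inverse prod.inject)
  next
    case False
    then have "{r \<in> {S..<?S}. (p', i') = (p, i)} = {}" by simp
    moreover have "card {r \<in> {?S..<?S + ?N}. scan_spec t r xs ?S = (p, i)} = t p i"
      using Cons.prems x False by (intro Cons.IH) auto
    ultimately show ?thesis unfolding N split by (simp only: Un_empty_left)
  qed
qed simp

text \<open>The list is sorted by first components, so no visited pair exceeds the returned one
  there. The bound counts all pairs with this property, including those after the stopping
  point.\<close>

lemma snd_run_scan_le:
  assumes "successively lex_step xs"
    and "xs \<noteq> [] \<Longrightarrow> snd (hd xs) = 0 \<or> c = cofactor n k (fst (hd xs)) (snd (hd xs) - 1)"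
    and "sorted_wrt (\<lambda>x y. fst x \<le> fst y) xs"
    and "r < S + (\<Sum>(p, i)\<leftarrow>xs. T n m k p i)"
  shows "snd (run_state (scan n m k r xs S c) q) \<le>
    q + 4 * length (filter (\<lambda>x. 0 < snd x \<and> fst x \<le> fst (scan_spec (T n m k) r xs S)) xs)"
  using assms
proof (induction xs arbitrary: S c q)
  case (Cons x xs)
  obtain p i where x: "x = (p, i)" by fastforce
  obtain c' q1 where 1: "run_state (next_cofactor n k p i c) q = (c', q1)" by fastforce
  have c': "c' = cofactor n k p i"
    using run_next_cofactor[of i c n k p q] Cons.prems(2) 1 x by simp
  obtain t q2 where 2: "run_state (term_value n m k p i c') q1 = (t, q2)" by fastforce
  have t: "t = T n m k p i"
    using run_term_value[of n m k p i q1] 2 c' by simp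
  \<comment> \<open>For \<open>i > 0\<close> there are two products and one exact division in
    \<open>next_cofactor\<close> and one product in \<open>term_value\<close>.\<close>
  have q2: "q2 = q + (if 0 < i then 4 else 0)"
    using 1 2 by (auto simp: next_cofactor_def term_value_def mul_def exact_div_def Let_def split: if_splits)
  show ?case
  proof (cases "r < S + t")
    case True
    then show ?thesis using x 1 2 t q2 by simp
  next
    case False
    let ?res = "scan_spec (T n m k) r xs (S + t)"
    have "snd (run_state (scan n m k r xs (S + t) c') q2) \<le>
        q2 + 4 * length (filter (\<lambda>x. 0 < snd x \<and> fst x \<le> fst ?res) xs)"
    proof (rule Cons.IH)
      show "successively lex_step xs" using Cons.prems(1) by (cases xs) auto
      show "sorted_wrt (\<lambda>x y. fst x \<le> fst y) xs" using Cons.prems(3) by simp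
      show "r < S + t + (\<Sum>(p, i)\<leftarrow>xs. T n m k p i)" using Cons.prems(4) x t by simp
      assume "xs \<noteq> []"
      then show "snd (hd xs) = 0 \<or> c' = cofactor n k (fst (hd xs)) (snd (hd xs) - 1)"
        using Cons.prems(1) x c' by (cases xs) (auto simp: lex_step_def)
    qed
    \<comment> \<open>The result lies further down the sorted list, so the current pair is among
      those counted by the bound.\<close>
    moreover have "?res \<in> set xs"
      using scan_spec_result(1)[of "S + t" r "T n m k" xs] False Cons.prems(4) x t by simp
    then have "p \<le> fst ?res" using Cons.prems(3) x by auto
    ultimately show ?thesis using x 1 2 t q2 False by (cases i) simp_all
  qed
qed simp

lemma pick_pair:
  assumes k: "1 \<le> k" and r: "r < D (Suc (Suc l)) m k"
  obtains p i q where "run_state (pick_pair (Suc (Suc l)) m k r) 0 = ((p, i), q)"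
    "scan_spec (T (Suc (Suc l)) m k) r (lex_pairs m) 0 = (p, i)"
    "i \<le> p" "p \<le> m" "0 < T (Suc (Suc l)) m k p i" "q \<le> 4 * p\<^sup>2"
proof -
  let ?n = "Suc (Suc l)"
  obtain p i q where pq: "run_state (pick_pair ?n m k r) 0 = ((p, i), q)" by (metis prod.exhaust)
  have res: "scan_spec (T ?n m k) r (lex_pairs m) 0 = (p, i)"
    using fst_run_pick_pair[of ?n m k r 0] pq by simp
  have r': "r < 0 + (\<Sum>(p, i)\<leftarrow>lex_pairs m. T ?n m k p i)" using r D_recurrence[OF k] by simp
  have pi: "i \<le> p" "p \<le> m" "0 < T ?n m k p i"
    using scan_spec_result[OF le0 r'] res by (auto simp: set_lex_pairs)
  let ?f = "filter (\<lambda>x. 0 < snd x \<and> fst x \<le> p) (lex_pairs m)"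
  have "snd (run_state (scan ?n m k r (lex_pairs m) 0 1) 0) \<le>
      0 + 4 * length (filter (\<lambda>x. 0 < snd x \<and> fst x \<le> fst (scan_spec (T ?n m k) r (lex_pairs m) 0)) (lex_pairs m))"
  proof (rule snd_run_scan_le[OF successively_lex_pairs _ sorted_lex_pairs r'])
    show "snd (hd (lex_pairs m)) = 0 \<or>
        1 = cofactor ?n k (fst (hd (lex_pairs m))) (snd (hd (lex_pairs m)) - 1)"
      by (simp add: lex_pairs_def upt_conv_Cons del: upt_Suc)
  qed
  then have "q \<le> 4 * length ?f" using pq res by (simp add: pick_pair_def)
  also have "length ?f = card (set ?f)"
    using distinct_card[OF distinct_filter[OF distinct_lex_pairs]] by simp
  \<comment> \<open>Every counted pair \<open>(p', i')\<close> satisfies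
    \<open>1 \<le> i' \<le> p' \<le> p\<close>. In particular there is none for
    \<open>p = 0\<close>, which is why the bound has no additive constant.\<close>
  also have "card (set ?f) \<le> card ({1..p} \<times> {1..p})"
    by (rule card_mono) (auto simp: set_lex_pairs)
  finally have "q \<le> 4 * p\<^sup>2" by (simp add: power2_eq_square)
  then show ?thesis by (rule that[OF pq res pi])
qed


section \<open>Distribution and cost of the sampler\<close>

lemma D_pos_imp:
  assumes "0 < D (Suc n) m k"
  shows "1 \<le> k" "doags (Suc n) m k \<noteq> {}"
proof -
  show "doags (Suc n) m k \<noteq> {}" using assms by (auto simp: D_def)
  then obtain C where "C \<in> doags (Suc n) m k" by blast
  then show "1 \<le> k" by (rule doags_unique_extension)
qed

text \<open>All new edges leave \<open>x\<close>, so the old out-degrees stay and the sum grows by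
  \<open>p\<^sup>2\<close>, which pays for one search.\<close>

lemma sum_out_degree_add_source:
  assumes G: "is_doag G" and x: "x \<notin> verts G" and E: "E \<in> target_lists p i G"
  shows "(\<Sum>v\<in>verts (add_source x E G). (out_degree (add_source x E G) v)\<^sup>2) =
    p\<^sup>2 + (\<Sum>v\<in>verts G. (out_degree G v)\<^sup>2)"
proof -
  have "edges (add_source x E G) `` {x} = set E" using x is_doagD(2)[OF G] by auto
  moreover have "distinct E" "length E = p" using E by (auto simp: target_lists_def valid_targets_def)
  ultimately have new: "out_degree (add_source x E G) x = p"
    using distinct_card[of E] by (simp add: out_degree_eq del: add_source_simps)
  have old: "out_degree (add_source x E G) v = out_degree G v" if "v \<in> verts G" for v
  proof -
    have "edges (add_source x E G) `` {v} = edges G `` {v}" using x that by auto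
    then show ?thesis by (simp only: out_degree_eq)
  qed
  have "(\<Sum>v\<in>verts (add_source x E G). (out_degree (add_source x E G) v)\<^sup>2) =
      (out_degree (add_source x E G) x)\<^sup>2 + (\<Sum>v\<in>verts G. (out_degree (add_source x E G) v)\<^sup>2)"
    using x is_doagD(1)[OF G] by simp
  then show ?thesis using new old by simp
qed

text \<open>The invariant of the recursion. That the vertices are exactly the numbers below
  \<open>n\<close> makes \<open>n\<close> fresh for the enclosing call; the constant 4 is that of
  \<open>pick_pair\<close>.\<close>

definition good_output :: "nat \<Rightarrow> nat \<Rightarrow> nat \<Rightarrow> nat dograph \<times> nat \<Rightarrow> bool" where
  "good_output n m k = (\<lambda>(G, q). G \<in> doag_set n m k \<and> verts G = {..<n} \<and>
     q \<le> 4 * (\<Sum>v\<in>verts G. (out_degree G v)\<^sup>2))"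

text \<open>Merges the choices of \<open>I\<close>, \<open>xs\<close> and \<open>E\<close> into one
  uniform choice. This requires the recursive call to return DOAGs with the requested parameters;
  \<open>IH\<close> is an explicit hypothesis because the induction that proves it uses this very
  equation.\<close>

lemma UnifDOAG_unfold:
  assumes D: "0 < D (Suc (Suc l)) m k"
    and IH: "\<forall>m' k'. 0 < D (Suc l) m' k' \<longrightarrow>
      (\<forall>z\<in>set_pmf (UnifDOAG (Suc l) m' k'). good_output (Suc l) m' k' z)"
  shows "UnifDOAG (Suc (Suc l)) m k = do {
       r \<leftarrow> pmf_of_set {0..<D (Suc (Suc l)) m k};
       let ((p, i), q) = run_state (pick_pair (Suc (Suc l)) m k r) 0;
       (G, q') \<leftarrow> UnifDOAG (Suc l) (m - p) (k - 1 + p - i);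
       E \<leftarrow> pmf_of_set (target_lists p i G);
       return_pmf (add_source (Suc l) E G, q + q')
     }"
  unfolding UnifDOAG.simps(2)
proof (rule bind_pmf_cong[OF refl])
  let ?n = "Suc (Suc l)"
  note k = D_pos_imp(1)[OF D]
  fix r assume "r \<in> set_pmf (pmf_of_set {0..<D ?n m k})"
  then have "r < D ?n m k" using D by (simp add: set_pmf_of_set)
  then obtain p i q where run: "run_state (pick_pair ?n m k r) 0 = ((p, i), q)"
    and pi: "i \<le> p" "p \<le> m" "0 < T ?n m k p i"
    by (rule pick_pair[OF k])
  have D': "0 < D (Suc l) (m - p) (k - 1 + p - i)" and cof: "0 < cofactor ?n k p i"
    using pi(3) by (simp_all add: T_eq)
  have "(do {
       (G, q') \<leftarrow> UnifDOAG (Suc l) (m - p) (k - 1 + p - i);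
       I \<leftarrow> pmf_of_set {I. I \<subseteq> verts G - sources G \<and> card I = i};
       xs \<leftarrow> pmf_of_set (permutations_of_set I);
       E \<leftarrow> pmf_of_set (shuffles xs (largest_sources (p - i) G));
       return_pmf (add_source (Suc l) E G, q + q')}) = (do {
       (G, q') \<leftarrow> UnifDOAG (Suc l) (m - p) (k - 1 + p - i);
       E \<leftarrow> pmf_of_set (target_lists p i G);
       return_pmf (add_source (Suc l) E G, q + q')})"
  proof (rule bind_pmf_cong[OF refl])
    fix z assume z: "z \<in> set_pmf (UnifDOAG (Suc l) (m - p) (k - 1 + p - i))"
    obtain G q' where zG: "z = (G, q')" by fastforce
    have G: "G \<in> doag_set (Suc l) (m - p) (k - 1 + p - i)"
      using IH[rule_format, OF D' z] zG by (simp add: good_output_def)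
    have s: "p - i \<le> card (sources G)" using doag_setD(4)[OF G] k pi by simp
    \<comment> \<open>A positive term makes the set of lists nonempty, so \<open>G\<close> has at
      least \<open>i\<close> non-sources.\<close>
    have "0 < card (target_lists p i G)" using card_target_lists[OF G pi(1) k] cof by simp
    then have i: "i \<le> card (verts G - sources G)"
      unfolding pmf_of_set_target_lists(1)[OF doag_setD(1)[OF G] pi(1) s] by (simp add: zero_less_binomial_iff)
    show "(case z of (G, q') \<Rightarrow> do {
       I \<leftarrow> pmf_of_set {I. I \<subseteq> verts G - sources G \<and> card I = i};
       xs \<leftarrow> pmf_of_set (permutations_of_set I);
       E \<leftarrow> pmf_of_set (shuffles xs (largest_sources (p - i) G));
       return_pmf (add_source (Suc l) E G, q + q')}) = (case z of (G, q') \<Rightarrow> do {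
       E \<leftarrow> pmf_of_set (target_lists p i G);
       return_pmf (add_source (Suc l) E G, q + q')})"
      unfolding zG prod.case pmf_of_set_target_lists(2)[OF doag_setD(1)[OF G] pi(1) s i] bind_assoc_pmf
      by (rule refl)
  qed
  then show "(let ((p, i), q) = run_state (pick_pair ?n m k r) 0 in do {
       (G, q') \<leftarrow> UnifDOAG (Suc l) (m - p) (k - 1 + p - i);
       I \<leftarrow> pmf_of_set {I. I \<subseteq> verts G - sources G \<and> card I = i};
       xs \<leftarrow> pmf_of_set (permutations_of_set I);
       E \<leftarrow> pmf_of_set (shuffles xs (largest_sources (p - i) G));
       return_pmf (add_source (Suc l) E G, q + q')}) =
     (let ((p, i), q) = run_state (pick_pair ?n m k r) 0 in do {
       (G, q') \<leftarrow> UnifDOAG (Suc l) (m - p) (k - 1 + p - i);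
       E \<leftarrow> pmf_of_set (target_lists p i G);
       return_pmf (add_source (Suc l) E G, q + q')})"
    unfolding run Let_def prod.case .
qed

lemma UnifDOAG_good_output:
  assumes "0 < D (Suc n) m k" "z \<in> set_pmf (UnifDOAG (Suc n) m k)"
  shows "good_output (Suc n) m k z"
  using assms
proof (induction n arbitrary: m k z)
  case 0
  obtain G where "G \<in> doag_set (Suc 0) m k" using D_pos_imp(2)[OF 0(1)] by (auto simp: doags_eq)
  then have "single_vertex \<in> doag_set (Suc 0) m k" by (rule doag_class_single_vertex)
  then show ?case using 0(2) by (auto simp: good_output_def single_vertex_def)
next
  case (Suc l)
  let ?n = "Suc (Suc l)"
  note k = D_pos_imp(1)[OF Suc.prems(1)]
  have IH: "\<forall>m' k'. 0 < D (Suc l) m' k' \<longrightarrow>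
      (\<forall>z\<in>set_pmf (UnifDOAG (Suc l) m' k'). good_output (Suc l) m' k' z)"
    using Suc.IH by blast
  obtain r where r: "r \<in> set_pmf (pmf_of_set {0..<D ?n m k})"
    and z: "z \<in> set_pmf (let ((p, i), q) = run_state (pick_pair ?n m k r) 0 in do {
       (G, q') \<leftarrow> UnifDOAG (Suc l) (m - p) (k - 1 + p - i);
       E \<leftarrow> pmf_of_set (target_lists p i G);
       return_pmf (add_source (Suc l) E G, q + q')})"
    using Suc.prems(2) unfolding UnifDOAG_unfold[OF Suc.prems(1) IH]
    by (elim set_bind_pmf[THEN equalityD1, THEN subsetD, THEN UN_E])
  have "r < D ?n m k" using r Suc.prems(1) by (simp add: set_pmf_of_set)
  then obtain p i q where run: "run_state (pick_pair ?n m k r) 0 = ((p, i), q)"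
    and pi: "i \<le> p" "p \<le> m" "0 < T ?n m k p i" and q: "q \<le> 4 * p\<^sup>2"
    by (rule pick_pair[OF k])
  have D': "0 < D (Suc l) (m - p) (k - 1 + p - i)" and cof: "0 < cofactor ?n k p i"
    using pi(3) by (simp_all add: T_eq)
  obtain G q' where Gq: "(G, q') \<in> set_pmf (UnifDOAG (Suc l) (m - p) (k - 1 + p - i))"
    and z: "z \<in> set_pmf (do {E \<leftarrow> pmf_of_set (target_lists p i G);
       return_pmf (add_source (Suc l) E G, q + q')})"
    using z unfolding run Let_def prod.case set_bind_pmf by force
  have G: "G \<in> doag_set (Suc l) (m - p) (k - 1 + p - i)" "verts G = {..<Suc l}"
    and q': "q' \<le> 4 * (\<Sum>v\<in>verts G. (out_degree G v)\<^sup>2)"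
    using Suc.IH[OF D' Gq] unfolding good_output_def prod.case by blast+
  have fresh: "Suc l \<notin> verts G" using G(2) by simp
  have "0 < card (target_lists p i G)"
    using cof by (simp only: card_target_lists[OF G(1) pi(1) k])
  then have "finite (target_lists p i G)" "target_lists p i G \<noteq> {}" by (simp_all add: card_gt_0_iff)
  then obtain E where E: "E \<in> target_lists p i G" and zE: "z = (add_source (Suc l) E G, q + q')"
    using z by (auto simp: set_pmf_of_set)
  have "add_source (Suc l) E G \<in> doag_set ?n m k"
    by (rule add_source_in_doag_set[OF G(1) fresh E pi(2) k])
  moreover have "verts (add_source (Suc l) E G) = {..<?n}"
    by (simp only: add_source_simps G(2) lessThan_Suc)
  moreover have "q + q' \<le> 4 * (\<Sum>v\<in>verts (add_source (Suc l) E G). (out_degree (add_source (Suc l) E G) v)\<^sup>2)"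
    unfolding sum_out_degree_add_source[OF doag_setD(1)[OF G(1)] fresh E] distrib_left using q q' by linarith
  ultimately show ?case unfolding good_output_def zE prod.case by blast
qed

text \<open>Only draws \<open>r\<close> that select the pair of \<open>C\<close> contribute. For
  each of them the smaller class is the right one with probability \<open>1 / D\<close> for the
  reduced parameters, by induction, and one list among \<open>cofactor\<close> many leads to
  \<open>C\<close>; the product is \<open>1 / T\<close>. There are \<open>T\<close> such draws, so
  \<open>C\<close> receives total weight 1 out of \<open>D n m k\<close>.\<close>

lemma map_doag_class_UnifDOAG:
  assumes "0 < D (Suc n) m k"
  shows "map_pmf (\<lambda>(G, q). doag_class G) (UnifDOAG (Suc n) m k) = pmf_of_set (doags (Suc n) m k)"
  using assms
proof (induction n arbitrary: m k)
  case 0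
  have sub: "doags (Suc 0) m k \<subseteq> {doag_class single_vertex}"
    using doag_class_single_vertex(2) by (auto simp: doags_eq)
  then have "doags (Suc 0) m k = {doag_class single_vertex}" using D_pos_imp(2)[OF 0] by blast
  then show ?case by (simp add: pmf_of_set_singleton)
next
  case (Suc l)
  let ?n = "Suc (Suc l)"
  let ?P = "map_pmf (\<lambda>(G, q). doag_class G) (UnifDOAG ?n m k)"
  note k = D_pos_imp(1)[OF Suc.prems] and ne = D_pos_imp(2)[OF Suc.prems]
  \<comment> \<open>The conditional law of the class given \<open>r\<close>, with the count of
    multiplications projected away.\<close>
  define f where "f = (\<lambda>r. case fst (run_state (pick_pair ?n m k r) 0) of (p, i) \<Rightarrow> do {
       G \<leftarrow> map_pmf fst (UnifDOAG (Suc l) (m - p) (k - 1 + p - i));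
       map_pmf (\<lambda>E. doag_class (add_source (Suc l) E G)) (pmf_of_set (target_lists p i G))})"
  have IH: "\<forall>m' k'. 0 < D (Suc l) m' k' \<longrightarrow>
      (\<forall>z\<in>set_pmf (UnifDOAG (Suc l) m' k'). good_output (Suc l) m' k' z)"
    using UnifDOAG_good_output by blast
  have P: "?P = bind_pmf (pmf_of_set {0..<D ?n m k}) f"
    unfolding UnifDOAG_unfold[OF Suc.prems IH] map_bind_pmf
  proof (rule bind_pmf_cong[OF refl])
    fix r
    obtain p i q where run: "run_state (pick_pair ?n m k r) 0 = ((p, i), q)" by (metis prod.exhaust)
    show "map_pmf (\<lambda>(G, q). doag_class G) (let ((p, i), q) = run_state (pick_pair ?n m k r) 0 in do {
       (G, q') \<leftarrow> UnifDOAG (Suc l) (m - p) (k - 1 + p - i);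
       E \<leftarrow> pmf_of_set (target_lists p i G);
       return_pmf (add_source (Suc l) E G, q + q')}) = f r"
      unfolding f_def run Let_def prod.case fst_conv map_bind_pmf bind_map_pmf
    proof (rule bind_pmf_cong[OF refl])
      fix z :: "nat dograph \<times> nat"
      obtain G q' where z: "z = (G, q')" by fastforce
      show "map_pmf (\<lambda>(G, q). doag_class G) (case z of (G, q') \<Rightarrow> do {
          E \<leftarrow> pmf_of_set (target_lists p i G);
          return_pmf (add_source (Suc l) E G, q + q')}) =
        map_pmf (\<lambda>E. doag_class (add_source (Suc l) E (fst z))) (pmf_of_set (target_lists p i (fst z)))"
        by (simp add: z map_pmf_def bind_assoc_pmf bind_return_pmf)
    qed
  qed
  show ?case
  proof (rule pmf_eqI)
    fix C
    show "pmf ?P C = pmf (pmf_of_set (doags ?n m k)) C"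
    proof (cases "C \<in> doags ?n m k")
      case False
      have "C \<notin> set_pmf ?P"
      proof
        assume "C \<in> set_pmf ?P"
        then obtain z where z: "z \<in> set_pmf (UnifDOAG ?n m k)" "C = doag_class (fst z)"
          by (auto simp del: UnifDOAG.simps)
        then have "fst z \<in> doag_set ?n m k"
          using UnifDOAG_good_output[OF Suc.prems z(1)] by (cases z) (simp add: good_output_def)
        then show False using False z(2) by (simp add: doags_eq)
      qed
      then have "pmf ?P C = 0" by (rule pmf_eq_0_set_pmf[THEN iffD2])
      also have "0 = pmf (pmf_of_set (doags ?n m k)) C"
        using False by (simp add: pmf_of_set[OF ne finite_doags])
      finally show ?thesis .
    next
      case True
      obtain p0 i0 c0 where pi0: "i0 \<le> p0" "p0 \<le> m"
        and c0: "c0 \<in> doags (Suc l) (m - p0) (k - 1 + p0 - i0)"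
        and ext: "\<And>p i x (G :: nat dograph). is_doag G \<Longrightarrow> x \<notin> verts G \<Longrightarrow>
         card {E \<in> target_lists p i G. doag_class (add_source x E G) = C} =
           (if p = p0 \<and> i = i0 \<and> doag_class G = c0 then 1 else (0::nat))"
        using True by (rule doags_unique_extension) (rule that)
      let ?T = "T ?n m k p0 i0"
      have fr: "pmf (f r) C = (if scan_spec (T ?n m k) r (lex_pairs m) 0 = (p0, i0) then 1 / ?T else 0)"
        if r: "r \<in> {0..<D ?n m k}" for r
      proof -
        have "r < D ?n m k" using r by simp
        then obtain p i q where run: "run_state (pick_pair ?n m k r) 0 = ((p, i), q)"
          and spec: "scan_spec (T ?n m k) r (lex_pairs m) 0 = (p, i)"
          and pi: "i \<le> p" "p \<le> m" "0 < T ?n m k p i"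
          by (rule pick_pair[OF k])
        let ?U = "UnifDOAG (Suc l) (m - p) (k - 1 + p - i)"
        let ?c = "cofactor ?n k p i"
        let ?b = "p = p0 \<and> i = i0"
        have D': "0 < D (Suc l) (m - p) (k - 1 + p - i)" and cof: "0 < ?c"
          using pi(3) by (simp_all add: T_eq)
        \<comment> \<open>The value depends on \<open>G\<close> through its class only, so
          uniformity over classes in the recursive call is enough.\<close>
        have inner: "pmf (map_pmf (\<lambda>E. doag_class (add_source (Suc l) E G)) (pmf_of_set (target_lists p i G))) C =
            (if ?b then indicator {G. doag_class G = c0} G / ?c else 0)"
          if G: "G \<in> set_pmf (map_pmf fst ?U)" for G
        proof -
          obtain z where z: "z \<in> set_pmf ?U" "G = fst z" using G by auto
          have "good_output (Suc l) (m - p) (k - 1 + p - i) (fst z, snd z)"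
            using UnifDOAG_good_output[OF D' z(1)] by simp
          then have G: "G \<in> doag_set (Suc l) (m - p) (k - 1 + p - i)" "verts G = {..<Suc l}"
            unfolding good_output_def prod.case z(2) by blast+
          have fresh: "Suc l \<notin> verts G" using G(2) by simp
          have card: "card (target_lists p i G) = ?c" by (rule card_target_lists[OF G(1) pi(1) k])
          then have "finite (target_lists p i G)" "target_lists p i G \<noteq> {}"
            using cof card_gt_0_iff[of "target_lists p i G"] by simp_all
          then have "pmf (map_pmf (\<lambda>E. doag_class (add_source (Suc l) E G)) (pmf_of_set (target_lists p i G))) C =
              card {E \<in> target_lists p i G. doag_class (add_source (Suc l) E G) = C} / ?c"
            by (simp add: pmf_map measure_pmf_of_set card vimage_def Int_def)
          then show ?thesis using ext[OF doag_setD(1)[OF G(1)] fresh, of p i] by simp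
        qed
        have integral: "(\<integral>x. (if b then indicator A x / c else 0) \<partial>measure_pmf M) =
            (if b then measure (measure_pmf M) A / c else 0)"
          for M :: "nat dograph pmf" and A b and c :: real
          by simp
        have "pmf (f r) C = (\<integral>G. pmf (map_pmf (\<lambda>E. doag_class (add_source (Suc l) E G))
            (pmf_of_set (target_lists p i G))) C \<partial>measure_pmf (map_pmf fst ?U))"
          by (simp add: f_def run pmf_bind)
        \<comment> \<open>The integrands need to agree on the support only: \<open>inner\<close>
          speaks of graphs that the recursive call can return.\<close>
        also have "\<dots> = (\<integral>G. (if ?b then indicator {G. doag_class G = c0} G / ?c else 0)
            \<partial>measure_pmf (map_pmf fst ?U))"
          by (rule integral_cong_AE) (simp_all add: AE_measure_pmf_iff inner del: set_map_pmf)
        also have "\<dots> = (if ?b then measure (measure_pmf (map_pmf fst ?U)) {G. doag_class G = c0} / ?c else 0)"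
          by (rule integral)
        also have "measure (measure_pmf (map_pmf fst ?U)) {G. doag_class G = c0} =
            pmf (map_pmf doag_class (map_pmf fst ?U)) c0"
          by (simp add: pmf_map vimage_def)
        also have "map_pmf doag_class (map_pmf fst ?U) = pmf_of_set (doags (Suc l) (m - p) (k - 1 + p - i))"
          using Suc.IH[OF D'] by (simp add: pmf.map_comp o_def case_prod_beta)
        also have "(if ?b then pmf (pmf_of_set (doags (Suc l) (m - p) (k - 1 + p - i))) c0 / ?c else 0) =
            (if ?b then 1 / ?T else 0)"
        proof (cases ?b)
          case True
          then have "c0 \<in> doags (Suc l) (m - p) (k - 1 + p - i)" using c0 by simp
          then have "pmf (pmf_of_set (doags (Suc l) (m - p) (k - 1 + p - i))) c0 =
              1 / D (Suc l) (m - p) (k - 1 + p - i)"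
            unfolding D_def by (subst pmf_of_set[OF D_pos_imp(2)[OF D'] finite_doags]) simp
          then show ?thesis using True by (simp add: T_eq)
        next
          case False
          then show ?thesis by (simp only: if_False)
        qed
        finally show ?thesis using spec by simp
      qed
      have D_eq: "D ?n m k = 0 + (\<Sum>(p, i)\<leftarrow>lex_pairs m. T ?n m k p i)"
        using D_recurrence[OF k] by simp
      have card: "card {r \<in> {0..<D ?n m k}. scan_spec (T ?n m k) r (lex_pairs m) 0 = (p0, i0)} = ?T"
        unfolding D_eq
        by (rule card_scan_spec[OF distinct_lex_pairs]) (use pi0 in \<open>simp add: set_lex_pairs\<close>)
      \<comment> \<open>Needed for \<open>?T\<close> copies of \<open>1 / ?T\<close> to sum to 1.
        Some list leads to \<open>C\<close>, so neither factor of the term vanishes.\<close>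
      have "0 < ?T"
      proof -
        note G = class_rep[OF c0]
        have "card {E \<in> target_lists p0 i0 (class_rep c0).
            doag_class (add_source (fresh_vertex (class_rep c0)) E (class_rep c0)) = C} = 1"
          using ext[OF G(3) fresh_vertex[OF G(3)], of p0 i0] G(2) by simp
        moreover have "card {E \<in> target_lists p0 i0 (class_rep c0).
            doag_class (add_source (fresh_vertex (class_rep c0)) E (class_rep c0)) = C} \<le>
            card (target_lists p0 i0 (class_rep c0))"
          by (intro card_mono finite_target_lists[OF G(3)]) auto
        ultimately have "0 < cofactor ?n k p0 i0" using card_target_lists[OF G(1) pi0(1) k] by simp
        moreover have "0 < D (Suc l) (m - p0) (k - 1 + p0 - i0)"
          using c0 finite_doags by (auto simp: D_def card_gt_0_iff)
        ultimately show ?thesis by (simp add: T_eq)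
      qed
      have "pmf ?P C = (\<Sum>r\<in>{0..<D ?n m k}. pmf (f r) C) / D ?n m k"
        unfolding P using Suc.prems by (subst pmf_bind_pmf_of_set) auto
      also have "(\<Sum>r\<in>{0..<D ?n m k}. pmf (f r) C) = (\<Sum>r\<in>{0..<D ?n m k}.
          if scan_spec (T ?n m k) r (lex_pairs m) 0 = (p0, i0) then 1 / ?T else 0)"
        by (rule sum.cong[OF refl fr])
      also have "\<dots> = (\<Sum>r\<in>{r \<in> {0..<D ?n m k}. scan_spec (T ?n m k) r (lex_pairs m) 0 = (p0, i0)}. 1 / ?T)"
        by (rule sum.inter_filter[symmetric]) simp
      also have "\<dots> = 1" using card \<open>0 < ?T\<close> by (simp only: sum_constant) simp
      also have "1 / D ?n m k = pmf (pmf_of_set (doags ?n m k)) C"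
        using True by (simp add: pmf_of_set[OF ne finite_doags] D_def)
      finally show ?thesis .
    qed
  qed
qed

theorem theorem3p1:
  shows "(\<forall>n m k. 1 \<le> n \<and> 0 < D n m k \<longrightarrow>
            map_pmf (\<lambda>(G, q). doag_class G) (UnifDOAG n m k) = pmf_of_set (doags n m k)) \<and>
         (\<exists>C. \<forall>n m k. 1 \<le> n \<and> 0 < D n m k \<longrightarrow>
            (\<forall>(G, q)\<in>set_pmf (UnifDOAG n m k).
               q \<le> C * (\<Sum>v\<in>verts G. (out_degree G v)\<^sup>2)))"
proof (intro conjI allI impI exI[of _ 4] ballI)
  fix n m k :: nat
  assume "1 \<le> n \<and> 0 < D n m k"
  then obtain n' where n: "n = Suc n'" "0 < D (Suc n') m k" by (cases n) auto
  show "map_pmf (\<lambda>(G, q). doag_class G) (UnifDOAG n m k) = pmf_of_set (doags n m k)"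
    unfolding n(1) by (rule map_doag_class_UnifDOAG[OF n(2)])
  fix z assume "z \<in> set_pmf (UnifDOAG n m k)"
  then show "case z of (G, q) \<Rightarrow> q \<le> 4 * (\<Sum>v\<in>verts G. (out_degree G v)\<^sup>2)"
    using UnifDOAG_good_output[OF n(2)] n(1) by (auto simp: good_output_def)
qed

end
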